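(* Let $\triangle PQR$ be a (closed, filled) triangle in $D$ with $d'(P,R)=d'(Q,R)$, $d'(P,Q)>\log 9$ and $\delta(P,Q,R)>\frac{1}{2}\Delta_1'(P,Q)$. Then $\rho(\psi_{\triangle PQR})<\frac{2}{5}$.
   Context: $D$ is the open unit disk in $\mathbb R^2$, $S^1$ its boundary circle identified with $\mathbb R/\mathbb Z$ via the counterclockwise normalized angle. For a closed convex $U\subset D$ and $v\in S^1$, $\psi_U(v)$ is the point $w\in S^1\setminus\{v\}$ such that the line $vw$ meets $U$ and $U$ lies in the closed half-plane to the left of the directed line from $v$ to $w$; it is an orientation-preserving homeomorphism of $S^1$. For such $f$, $\rho(f)=\lim_{n\to\infty}(\overline f^n(x)-x)/n$ with $\overline f$ the lift to $\mathbb R$ satisfying $\overline f(0)\in[0,1)$. Regard $D$ as the Beltrami–Klein model (hyperbolic lines are chords). For distinct $P,Q\in D$ with chord endpoints $v_1,v_2\in S^1$, $d'(P,Q)=\tfrac12\left|\log\frac{|v_1Q||v_2P|}{|v_1P||v_2Q|}\right|$; $\Delta_n'(P,Q)=\log\frac{e^{n d'(P,Q)}+1}{e^{n d'(P,Q)}-1}$ for $n\in\mathbb Z_{>0}$; $\delta(P,Q,R)=\min\{d'(R,S): S \text{ on the chord through } P,Q\}$. *)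

theory Defs
  imports "HOL-Analysis.Analysis"
begin

text \<open>The plane is modelled by the complex numbers; D is the open unit disk
  ball 0 1, and S^1 = sphere 0 1 is parametrised by t \<mapsto> cis (2 pi t).\<close>

definition on_line :: "complex \<Rightarrow> complex \<Rightarrow> complex \<Rightarrow> bool" where
  "on_line a b z \<longleftrightarrow> (\<exists>t::real. z = a + of_real t * (b - a))"

definition left_of :: "complex \<Rightarrow> complex \<Rightarrow> complex \<Rightarrow> bool" where
  "left_of v w z \<longleftrightarrow> Im (cnj (w - v) * (z - v)) \<ge> 0"

definition psi :: "complex set \<Rightarrow> complex \<Rightarrow> complex" where
  "psi U v = (THE w. w \<in> sphere 0 1 \<and> w \<noteq> v \<and> (\<exists>z\<in>U. on_line v w z)
                     \<and> (\<forall>z\<in>U. left_of v w z))"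

definition circle_lift :: "(complex \<Rightarrow> complex) \<Rightarrow> real \<Rightarrow> real" where
  "circle_lift f = (THE F. continuous_on UNIV F \<and>
        (\<forall>x. cis (2 * pi * F x) = f (cis (2 * pi * x))) \<and> 0 \<le> F 0 \<and> F 0 < 1)"

definition rot_num :: "(complex \<Rightarrow> complex) \<Rightarrow> real" where
  "rot_num f = lim (\<lambda>n. ((circle_lift f ^^ n) 0 - 0) / real n)"

definition chord_ends :: "complex \<Rightarrow> complex \<Rightarrow> complex \<times> complex" where
  "chord_ends P Q = (SOME (v1, v2). v1 \<noteq> v2 \<and> v1 \<in> sphere 0 1 \<and> v2 \<in> sphere 0 1
        \<and> on_line P Q v1 \<and> on_line P Q v2)"

definition dK :: "complex \<Rightarrow> complex \<Rightarrow> real" where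
  "dK P Q = (if P = Q then 0 else
     (let (v1, v2) = chord_ends P Q in
       (1/2) * \<bar>ln ((cmod (Q - v1) * cmod (P - v2)) / (cmod (P - v1) * cmod (Q - v2)))\<bar>))"

definition DeltaK :: "nat \<Rightarrow> complex \<Rightarrow> complex \<Rightarrow> real" where
  "DeltaK n P Q = ln ((exp (real n * dK P Q) + 1) / (exp (real n * dK P Q) - 1))"

definition deltaK :: "complex \<Rightarrow> complex \<Rightarrow> complex \<Rightarrow> real" where
  "deltaK P Q R = Inf (dK R ` {S \<in> ball 0 1. on_line P Q S})"

end

theory Submission
  imports Defs "HOL-Library.Quadratic_Discriminant"
begin

text \<open>
  For a point \<open>Z\<close> of the disk let \<open>turn Z\<close> be the lift of the map sending \<open>v\<close> to the second end of
  the chord through \<open>v\<close> and \<open>Z\<close>, that is, of the half-turn about \<open>Z\<close> acting on the boundary. The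
  lift of \<open>psi\<close> for a triangle is the minimum \<open>F\<close> of the three turns about its vertices, so every word
  of length five in these turns bounds \<open>F\<^sup>5\<close> from above, and \<open>F\<^sup>5 x < x + 2\<close> for all \<open>x\<close> gives a
  rotation number below \<open>2/5\<close> by compactness.

  A hyperbolic isometry moves the triangle to \<open>P = p\<close>, \<open>Q = -p\<close>, \<open>R = \<i> r\<close>. In the coordinate
  \<open>t = tan (pi x)\<close> of the boundary the three turns are \<open>t \<mapsto> -1/(l t)\<close>, \<open>t \<mapsto> -l/t\<close> and
  \<open>t \<mapsto> (r t - 1)/(t - r)\<close> with \<open>l = exp (dK P Q) > 9\<close>, and the hypothesis on \<open>deltaK\<close> says
  \<open>r > 1/l\<close>. (For \<open>r = 1/l\<close> the points \<open>0, l, -1, 1/l, \<infinity>\<close> form a cycle with rotation number \<open>2/5\<close>.)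
  On \<open>0 \<le> t \<le> r\<close> the words \<open>PRPQR\<close> and \<open>PQRQR\<close> advance by less than two turns, for
  \<open>t \<le> r/2\<close> and \<open>t \<ge> r/2\<close> respectively, and five iterates of this interval cover the circle.
\<close>

subsection \<open>Lifts of half-turns\<close>

text \<open>With \<open>v = cis (2 * pi * x)\<close> and \<open>u = 1 - cnj Z * v\<close>, the chord
  through \<open>v\<close> and \<open>Z\<close> ends at \<open>- v * cnj u / u\<close>. For
  \<open>norm Z < 1\<close> we have \<open>Re u > 0\<close>, so the principal argument is continuous
  here and the displacement lies strictly between 0 and 1.\<close>

definition turn :: "complex \<Rightarrow> real \<Rightarrow> real" where
  "turn Z x = x + 1/2 - Arg (1 - cnj Z * cis (2 * pi * x)) / pi"

lemma Re_turn_pos: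
  assumes "norm Z < 1"
  shows "Re (1 - cnj Z * cis y) > 0"
proof -
  have "Re (cnj Z * cis y) \<le> norm (cnj Z * cis y)" by (rule complex_Re_le_cmod)
  also have "\<dots> < 1" using assms by (simp add: norm_mult)
  finally show ?thesis by simp
qed

lemma turn_bounds:
  assumes "norm Z < 1"
  shows "x < turn Z x" "turn Z x < x + 1"
proof -
  have "\<bar>Arg (1 - cnj Z * cis (2 * pi * x))\<bar> < pi / 2"
    using Re_turn_pos[OF assms] Arg_Re_pos by blast
  then show "x < turn Z x" "turn Z x < x + 1"
    by (auto simp: turn_def field_simps abs_less_iff)
qed

lemma turn_add_1: "turn Z (x + 1) = turn Z x + 1"
proof -
  have "cis (2 * pi * (x + 1)) = cis (2 * pi * x)"
    by (simp add: distrib_left flip: cis_mult)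
  then show ?thesis by (simp add: turn_def)
qed

lemma turn_rotate: "turn (Z * cis (2 * pi * \<theta>)) (x + \<theta>) = turn Z x + \<theta>"
proof -
  have "cnj (Z * cis (2 * pi * \<theta>)) * cis (2 * pi * (x + \<theta>)) = cnj Z * cis (2 * pi * x)"
    by (simp add: cis_cnj cis_mult algebra_simps)
  then show ?thesis unfolding turn_def by (simp only:)
qed

lemma continuous_on_turn:
  assumes "norm Z < 1"
  shows "continuous_on A (turn Z)"
proof -
  have "1 - cnj Z * cis (2 * pi * x) \<notin> \<real>\<^sub>\<le>\<^sub>0" for x
    using Re_turn_pos[OF assms, of "2 * pi * x"] by (auto simp: complex_nonpos_Reals_iff)
  then show ?thesis unfolding turn_def by (intro continuous_intros) auto
qed

text \<open>At half angles a turn is the real-linear map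
  \<open>u \<mapsto> \<i> * (u - Z * cnj u)\<close> up to a positive factor. Positivity matters:
  adding 1 to the parameter flips the sign of the half-angle vector.\<close>

lemma cis_turn:
  assumes "norm Z < 1"
  obtains c where "c > 0"
    "cis (pi * turn Z x) = of_real c * (\<i> * (cis (pi * x) - Z * cnj (cis (pi * x))))"
proof -
  define w where "w = 1 - cnj Z * cis (2 * pi * x)"
  have "Re w > 0" using Re_turn_pos[OF assms] by (simp add: w_def)
  then have w0: "w \<noteq> 0" by auto
  have "cis (pi * turn Z x) = cis (pi / 2) * cis (pi * x) * cnj (cis (Arg w))"
  proof -
    have "pi * turn Z x = pi / 2 + pi * x - Arg w"
      by (simp add: turn_def w_def[symmetric] right_diff_distrib distrib_left)
    then show ?thesis by (simp only: cis_mult cis_cnj) (simp add: algebra_simps)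
  qed
  also have "cis (Arg w) = w / of_real (norm w)"
    using w0 by (simp add: cis_Arg sgn_eq)
  finally have 1: "cis (pi * turn Z x) = of_real (1 / norm w) * (\<i> * (cis (pi * x) * cnj w))"
    by (simp add: field_simps)
  have "cis (pi * x) * cnj w = cis (pi * x) - Z * cnj (cis (pi * x))"
    by (simp add: w_def cis_cnj cis_mult algebra_simps)
  with 1 w0 that[of "1 / norm w"] show ?thesis by simp
qed

text \<open>The cross product of two half-angle vectors. Its sign orders \<open>x\<close> and
  \<open>y\<close> as soon as they are known to differ by less than 1.\<close>

lemma Im_cnj_cis: "Im (cnj (cis (pi * x)) * cis (pi * y)) = sin (pi * (y - x))"
  by (simp add: cis_cnj cis_mult algebra_simps)

lemma sin_pi_pos: "0 < d \<Longrightarrow> d < 1 \<Longrightarrow> sin (pi * d) > 0"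
  by (rule sin_gt_zero) auto

lemma sin_pi_neg:
  assumes "-1 < d" "d < 0" shows "sin (pi * d) < 0"
  using sin_pi_pos[of "-d"] assms by simp

lemma neg_if_sin_pi_neg:
  assumes "d < 1" "sin (pi * d) < 0" shows "d < 0"
  using assms sin_pi_pos[of d] by (cases "d = 0") (auto simp: not_less intro: ccontr)

lemma zero_if_sin_pi_zero:
  assumes "\<bar>d\<bar> < 1" "sin (pi * d) = 0" shows "d = 0"
  using assms sin_pi_pos[of d] sin_pi_neg[of d] by (auto simp: abs_less_iff) (metis less_irrefl not_less_iff_gr_or_eq)

lemma turn_eqI:
  assumes "norm Z < 1" "x < y" "y < x + 1"
    and "Im (cnj (cis (pi * y)) * (\<i> * (cis (pi * x) - Z * cnj (cis (pi * x))))) = 0"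
  shows "turn Z x = y"
proof -
  obtain c where c: "cis (pi * turn Z x) = of_real c * (\<i> * (cis (pi * x) - Z * cnj (cis (pi * x))))"
    using cis_turn[OF assms(1)] by blast
  have "Im (cnj (cis (pi * y)) * cis (pi * turn Z x)) = c * 0"
    unfolding c assms(4)[symmetric] by (simp add: algebra_simps)
  then have "sin (pi * (turn Z x - y)) = 0" by (simp only: Im_cnj_cis mult_zero_right)
  then show ?thesis
    using zero_if_sin_pi_zero[of "turn Z x - y"] turn_bounds[OF assms(1), of x] assms(2,3) by force
qed

lemma turn_strict_mono:
  assumes "norm Z < 1" "x < y"
  shows "turn Z x < turn Z y"
proof (cases "y < x + 1")
  case False
  then show ?thesis using turn_bounds[OF assms(1), of x] turn_bounds[OF assms(1), of y] by linarith
next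
  case True
  obtain c where c: "c > 0" "cis (pi * turn Z x) = of_real c * (\<i> * (cis (pi * x) - Z * cnj (cis (pi * x))))"
    using cis_turn[OF assms(1)] by blast
  obtain d where d: "d > 0" "cis (pi * turn Z y) = of_real d * (\<i> * (cis (pi * y) - Z * cnj (cis (pi * y))))"
    using cis_turn[OF assms(1)] by blast
  \<comment> \<open>The linear map of \<open>cis_turn\<close> has determinant
    \<open>1 - (norm Z)\<^sup>2\<close>, so up to the positive scalings it multiplies cross products
    by this positive number.\<close>
  have "Im (cnj (cis (pi * turn Z y)) * cis (pi * turn Z x))
      = c * d * ((1 - (norm Z)\<^sup>2) * Im (cnj (cis (pi * y)) * cis (pi * x)))"
    unfolding c d cmod_power2 by (simp add: algebra_simps power2_eq_square)
  then have "sin (pi * (turn Z x - turn Z y)) = c * d * ((1 - (norm Z)\<^sup>2) * sin (pi * (x - y)))"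
    by (simp only: Im_cnj_cis)
  moreover have "sin (pi * (x - y)) < 0" using True assms(2) by (intro sin_pi_neg) auto
  moreover have "1 - (norm Z)\<^sup>2 > 0" using assms(1) by (simp add: power_less_one_iff abs_square_less_1)
  ultimately have "sin (pi * (turn Z x - turn Z y)) < 0"
    using c(1) d(1) by (simp add: mult_pos_neg)
  then have "turn Z x - turn Z y < 0"
    using neg_if_sin_pi_neg turn_bounds[OF assms(1), of x] turn_bounds[OF assms(1), of y] assms(2) by force
  then show ?thesis by simp
qed

text \<open>The linear map squares to the negative scalar \<open>(norm Z)\<^sup>2 - 1\<close>, and a
  change of sign is a shift by 1. A lifted turn is thus an involution only up to one full
  turn.\<close>

lemma turn_turn:
  assumes "norm Z < 1"
  shows "turn Z (turn Z x) = x + 1"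
proof (rule turn_eqI[OF assms])
  show "turn Z x < x + 1" "x + 1 < turn Z x + 1" using turn_bounds[OF assms, of x] by auto
  obtain c where c: "c > 0" "cis (pi * turn Z x) = of_real c * (\<i> * (cis (pi * x) - Z * cnj (cis (pi * x))))"
    using cis_turn[OF assms(1)] by blast
  have "cis (pi * (x + 1)) = - cis (pi * x)" by (simp add: distrib_left flip: cis_mult)
  then show "Im (cnj (cis (pi * (x + 1))) * (\<i> * (cis (pi * turn Z x) - Z * cnj (cis (pi * turn Z x))))) = 0"
    unfolding c by (simp add: algebra_simps power2_eq_square)
qed

subsection \<open>The lift for a triangle\<close>

definition tri :: "complex \<Rightarrow> complex \<Rightarrow> complex \<Rightarrow> real \<Rightarrow> real" where
  "tri P Q R x = min (turn P x) (min (turn Q x) (turn R x))"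

text \<open>Inscribed angles: seen from the circle point at \<open>x\<close>, the direction of
  \<open>z\<close> is rotated from that of the point at \<open>y\<close> by
  \<open>pi * (turn z x - y)\<close>. The second equation solves the first for \<open>z\<close>,
  exhibiting it on the line when the angle vanishes.\<close>

lemma turn_side:
  assumes "norm z < 1" "x < y" "y < x + 1"
  obtains k where "k > 0"
    "cnj (cis (2 * pi * y) - cis (2 * pi * x)) * (z - cis (2 * pi * x)) = of_real k * cis (pi * (turn z x - y))"
    "z - cis (2 * pi * x) = of_real k * cis (pi * (turn z x - y)) * (cis (2 * pi * y) - cis (2 * pi * x)) / of_real ((norm (cis (2 * pi * y) - cis (2 * pi * x)))\<^sup>2)"
proof -
  obtain c where c: "c > 0" "cis (pi * turn z x) = of_real c * (\<i> * (cis (pi * x) - z * cnj (cis (pi * x))))"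
    using cis_turn[OF assms(1)] by blast
  have "cis (pi * turn z x) * cis (pi * x) = of_real c * (\<i> * (cis (pi * x) * cis (pi * x) - z * (cnj (cis (pi * x)) * cis (pi * x))))"
    unfolding c by (simp add: algebra_simps)
  also have "cnj (cis (pi * x)) * cis (pi * x) = 1" by (simp add: cis_cnj cis_mult)
  also have "cis (pi * x) * cis (pi * x) = cis (2 * pi * x)" by (simp add: cis_mult algebra_simps)
  finally have z: "z - cis (2 * pi * x) = of_real (1 / c) * \<i> * (cis (pi * turn z x) * cis (pi * x))"
    using c(1) by (simp add: mult.assoc[symmetric])
  have w: "cis (2 * pi * y) - cis (2 * pi * x) = of_real (2 * sin (pi * (y - x))) * \<i> * cis (pi * (x + y))"
  proof -
    have "cis (2 * pi * y) = cis (pi * (x + y)) * cis (pi * (y - x))"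
      "cis (2 * pi * x) = cis (pi * (x + y)) * cnj (cis (pi * (y - x)))"
      by (simp_all add: cis_mult cis_cnj algebra_simps)
    then have "cis (2 * pi * y) - cis (2 * pi * x)
        = cis (pi * (x + y)) * (cis (pi * (y - x)) - cnj (cis (pi * (y - x))))"
      by (simp add: algebra_simps)
    also have "cis (pi * (y - x)) - cnj (cis (pi * (y - x))) = of_real (2 * sin (pi * (y - x))) * \<i>"
      by (simp add: complex_eq_iff)
    finally show ?thesis by (simp add: algebra_simps)
  qed
  have s: "sin (pi * (y - x)) > 0" using assms by (intro sin_pi_pos) auto
  have e: "cnj (cis (pi * (x + y))) * (cis (pi * turn z x) * cis (pi * x)) = cis (pi * (turn z x - y))"
    by (simp add: cis_cnj cis_mult algebra_simps)
  define k where "k = 2 * sin (pi * (y - x)) / c"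
  have k: "k > 0" using s c(1) by (simp add: k_def)
  have 1: "cnj (cis (2 * pi * y) - cis (2 * pi * x)) * (z - cis (2 * pi * x)) = of_real k * cis (pi * (turn z x - y))"
  proof -
    have "cnj (cis (2 * pi * y) - cis (2 * pi * x)) * (z - cis (2 * pi * x))
        = of_real k * (cnj (cis (pi * (x + y))) * (cis (pi * turn z x) * cis (pi * x)))"
      unfolding w z k_def by (simp add: algebra_simps)
    then show ?thesis by (simp only: e)
  qed
  have nz: "cis (2 * pi * y) - cis (2 * pi * x) \<noteq> 0"
    unfolding w using s by simp
  have "z - cis (2 * pi * x) = of_real k * cis (pi * (turn z x - y)) * (cis (2 * pi * y) - cis (2 * pi * x)) / of_real ((norm (cis (2 * pi * y) - cis (2 * pi * x)))\<^sup>2)"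
  proof -
    have "d = cnj W * d * W / (W * cnj W)" if "W \<noteq> 0" for W d :: complex using that by simp
    from this[OF nz] show ?thesis unfolding 1[symmetric] complex_norm_square .
  qed
  with that k 1 show ?thesis by blast
qed

lemma left_of_iff_turn:
  assumes "norm z < 1" "x < y" "y < x + 1"
  shows "left_of (cis (2 * pi * x)) (cis (2 * pi * y)) z \<longleftrightarrow> y \<le> turn z x"
proof -
  obtain k where k: "k > 0"
    "cnj (cis (2 * pi * y) - cis (2 * pi * x)) * (z - cis (2 * pi * x)) = of_real k * cis (pi * (turn z x - y))"
    using turn_side[OF assms] by blast
  have "left_of (cis (2 * pi * x)) (cis (2 * pi * y)) z \<longleftrightarrow> 0 \<le> sin (pi * (turn z x - y))"
    unfolding left_of_def k(2) using k(1) by (simp add: zero_le_mult_iff)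
  moreover have "\<bar>turn z x - y\<bar> < 1" using turn_bounds[OF assms(1), of x] assms by auto
  ultimately show ?thesis
    using sin_pi_pos[of "turn z x - y"] sin_pi_neg[of "turn z x - y"]
    by (cases "turn z x" y rule: linorder_cases) (auto simp: abs_less_iff)
qed

lemma on_line_iff_turn:
  assumes "norm z < 1" "x < y" "y < x + 1"
  shows "on_line (cis (2 * pi * x)) (cis (2 * pi * y)) z \<longleftrightarrow> turn z x = y"
proof
  obtain k where k: "k > 0"
    "cnj (cis (2 * pi * y) - cis (2 * pi * x)) * (z - cis (2 * pi * x)) = of_real k * cis (pi * (turn z x - y))"
    "z - cis (2 * pi * x) = of_real k * cis (pi * (turn z x - y)) * (cis (2 * pi * y) - cis (2 * pi * x)) / of_real ((norm (cis (2 * pi * y) - cis (2 * pi * x)))\<^sup>2)"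
    using turn_side[OF assms] by blast
  {
    assume "on_line (cis (2 * pi * x)) (cis (2 * pi * y)) z"
    then obtain t where t: "z - cis (2 * pi * x) = of_real t * (cis (2 * pi * y) - cis (2 * pi * x))"
      unfolding on_line_def by (metis add_diff_cancel_left')
    have "Im (cnj (cis (2 * pi * y) - cis (2 * pi * x)) * (z - cis (2 * pi * x))) = 0"
      unfolding t by (simp add: algebra_simps)
    then have "sin (pi * (turn z x - y)) = 0" unfolding k(2) using k(1) by simp
    moreover have "\<bar>turn z x - y\<bar> < 1" using turn_bounds[OF assms(1), of x] assms by auto
    ultimately show "turn z x = y" using zero_if_sin_pi_zero by fastforce
  next
    assume "turn z x = y"
    with k(3) have "z = cis (2 * pi * x) + of_real (k / (norm (cis (2 * pi * y) - cis (2 * pi * x)))\<^sup>2) * (cis (2 * pi * y) - cis (2 * pi * x))"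
      by (simp add: algebra_simps)
    then show "on_line (cis (2 * pi * x)) (cis (2 * pi * y)) z" unfolding on_line_def by blast
  }
qed

lemma convex_left_of: "convex {z. left_of v w z}"
proof -
  have "{z. left_of v w z} = {z. inner (\<i> * (w - v)) z \<ge> inner (\<i> * (w - v)) v}"
    by (auto simp: left_of_def inner_complex_def algebra_simps)
  then show ?thesis by (simp add: convex_halfspace_ge)
qed

lemma sphere_cis_between:
  assumes "w \<in> sphere 0 1" "w \<noteq> cis (2 * pi * x)"
  obtains y where "x < y" "y < x + 1" "w = cis (2 * pi * y)"
proof -
  define a where "a = Arg w / (2 * pi)"
  define y where "y = a - of_int \<lfloor>a - x\<rfloor>"
  have "w = cis (2 * pi * a)" using assms cis_Arg[of w] by (cases "w = 0") (auto simp: a_def sgn_eq)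
  also have "\<dots> = cis (2 * pi * y) * cis (2 * pi * of_int \<lfloor>a - x\<rfloor>)"
    by (simp add: y_def cis_mult algebra_simps)
  also have "cis (2 * pi * of_int \<lfloor>a - x\<rfloor>) = 1" by (rule cis_multiple_2pi) auto
  finally have w: "w = cis (2 * pi * y)" by simp
  have "x \<le> y" "y < x + 1" unfolding y_def by linarith+
  moreover have "x \<noteq> y" using w assms by auto
  ultimately show ?thesis using that[OF _ _ w] by simp
qed

text \<open>A half-plane contains the hull as soon as it contains the vertices, and the smallest of
  the three turns belongs to a chord through a vertex, so this chord supports the triangle.\<close>

lemma psi_triangle:
  assumes "norm P < 1" "norm Q < 1" "norm R < 1"
  shows "psi (convex hull {P, Q, R}) (cis (2 * pi * x)) = cis (2 * pi * tri P Q R x)"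
proof -
  let ?U = "convex hull {P, Q, R}" and ?v = "cis (2 * pi * x)" and ?y = "tri P Q R x"
  have U: "norm z < 1" if "z \<in> ?U" for z
  proof -
    have "?U \<subseteq> ball 0 1" by (rule hull_minimal) (use assms in auto)
    with that show ?thesis by auto
  qed
  have vert: "P \<in> ?U" "Q \<in> ?U" "R \<in> ?U" by (auto intro: hull_inc)
  have y: "x < ?y" "?y < x + 1"
    using turn_bounds[OF assms(1), of x] turn_bounds[OF assms(2), of x] turn_bounds[OF assms(3), of x]
    by (auto simp: tri_def)
  have left: "\<forall>z\<in>?U. left_of ?v (cis (2 * pi * ?y)) z"
  proof -
    have "left_of ?v (cis (2 * pi * ?y)) z" if "z \<in> {P, Q, R}" for z
      using that assms by (subst left_of_iff_turn[OF _ y]) (auto simp: tri_def)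
    then have "?U \<subseteq> {z. left_of ?v (cis (2 * pi * ?y)) z}"
      by (intro hull_minimal convex_left_of) auto
    then show ?thesis by auto
  qed
  have line: "\<exists>z\<in>?U. on_line ?v (cis (2 * pi * ?y)) z"
  proof -
    have "turn P x = ?y \<or> turn Q x = ?y \<or> turn R x = ?y" by (auto simp: tri_def min_def)
    then show ?thesis using vert assms on_line_iff_turn[OF _ y] by metis
  qed
  show ?thesis unfolding psi_def
  proof (rule the_equality)
    have "cis (2 * pi * ?y) \<noteq> ?v"
      using turn_side[OF assms(1) y] by (metis cis_neq_zero complex_cnj_zero diff_self
          less_irrefl mult_eq_0_iff of_real_eq_0_iff)
    with left line show "cis (2 * pi * ?y) \<in> sphere 0 1 \<and> cis (2 * pi * ?y) \<noteq> ?v \<and>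
       (\<exists>z\<in>?U. on_line ?v (cis (2 * pi * ?y)) z) \<and> (\<forall>z\<in>?U. left_of ?v (cis (2 * pi * ?y)) z)" by simp
  next
    fix w assume w: "w \<in> sphere 0 1 \<and> w \<noteq> ?v \<and> (\<exists>z\<in>?U. on_line ?v w z) \<and> (\<forall>z\<in>?U. left_of ?v w z)"
    then obtain u where u: "x < u" "u < x + 1" "w = cis (2 * pi * u)"
      using sphere_cis_between by metis
    from w obtain z where z: "z \<in> ?U" "on_line ?v w z" by auto
    from line obtain z' where z': "z' \<in> ?U" "on_line ?v (cis (2 * pi * ?y)) z'" by auto
    \<comment> \<open>Both chords meet the hull and leave it on their left; testing each against the
      contact point of the other gives both \<open>u \<le> ?y\<close> and
      \<open>?y \<le> u\<close>.\<close>
    have "turn z x = u" "turn z' x = ?y"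
      using z z' u y U on_line_iff_turn by auto
    moreover have "turn z' x \<ge> u" using w z' u U left_of_iff_turn by auto
    moreover have "turn z x \<ge> ?y" using left z y U left_of_iff_turn by auto
    ultimately show "w = cis (2 * pi * ?y)" using u by simp
  qed
qed

context
  fixes P Q R :: complex
  assumes P: "norm P < 1" and Q: "norm Q < 1" and R: "norm R < 1"
begin

lemma tri_bounds: "x < tri P Q R x" "tri P Q R x < x + 1"
  using turn_bounds[OF P, of x] turn_bounds[OF Q, of x] turn_bounds[OF R, of x]
  by (auto simp: tri_def)

lemma tri_strict_mono: "x < y \<Longrightarrow> tri P Q R x < tri P Q R y"
  using turn_strict_mono[OF P, of x y] turn_strict_mono[OF Q, of x y] turn_strict_mono[OF R, of x y]
  by (auto simp: tri_def min_def)

lemma continuous_on_tri: "continuous_on A (tri P Q R)"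
  unfolding tri_def by (intro continuous_intros continuous_on_turn P Q R)

text \<open>Two lifts of the same map differ by a continuous integer-valued function, hence by a
  constant; both values at 0 lie in [0, 1), so the constant is 0.\<close>

lemma circle_lift_triangle: "circle_lift (psi (convex hull {P, Q, R})) = tri P Q R"
  unfolding circle_lift_def
proof (rule the_equality)
  show "continuous_on UNIV (tri P Q R) \<and>
    (\<forall>x. cis (2 * pi * tri P Q R x) = psi (convex hull {P, Q, R}) (cis (2 * pi * x))) \<and>
    0 \<le> tri P Q R 0 \<and> tri P Q R 0 < 1"
    using continuous_on_tri psi_triangle[OF P Q R] tri_bounds[of 0] by auto
next
  fix F assume F: "continuous_on UNIV F \<and>
    (\<forall>x. cis (2 * pi * F x) = psi (convex hull {P, Q, R}) (cis (2 * pi * x))) \<and> 0 \<le> F 0 \<and> F 0 < 1"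
  define d where "d x = F x - tri P Q R x" for x
  have int: "d x \<in> \<int>" for x
  proof -
    have "cis (2 * pi * F x) = cis (2 * pi * tri P Q R x)" using F psi_triangle[OF P Q R] by simp
    then obtain n :: int where "2 * pi * F x = 2 * pi * tri P Q R x + 2 * pi * of_int n"
      by (metis sin_cos_eq_iff cis.sel)
    then have "2 * pi * d x = 2 * pi * of_int n" by (simp add: d_def algebra_simps)
    then have "d x = of_int n" by simp
    then show ?thesis by simp
  qed
  have "continuous_on UNIV d" unfolding d_def using F continuous_on_tri by (intro continuous_intros) auto
  moreover have "\<exists>e>0. \<forall>y. y \<in> UNIV \<and> d y \<noteq> d x \<longrightarrow> e \<le> norm (d y - d x)" for x
  proof (intro exI[of _ 1] conjI allI impI)
    fix y assume "y \<in> UNIV \<and> d y \<noteq> d x"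
    then have "d y - d x \<in> \<int>" "d y - d x \<noteq> 0" using int by auto
    then show "1 \<le> norm (d y - d x)" by (simp add: Ints_nonzero_abs_ge1)
  qed simp
  ultimately have "d constant_on UNIV" by (intro continuous_discrete_range_constant) auto
  then obtain c where c: "\<And>x. d x = c" by (auto simp: constant_on_def)
  have "\<bar>d 0\<bar> < 1" using F tri_bounds[of 0] by (auto simp: d_def)
  with int[of 0] have "d 0 = 0" by (meson Ints_nonzero_abs_ge1 not_le)
  then have "d x = 0" for x using c by metis
  then show "F = tri P Q R" by (auto simp: d_def)
qed

end

lemma tri_add_1: "tri P Q R (x + 1) = tri P Q R x + 1"
  by (simp add: tri_def turn_add_1)

subsection \<open>Rotation numbers\<close>

locale circle_map_lift =
  fixes F :: "real \<Rightarrow> real"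
  assumes cont: "continuous_on UNIV F" and mono: "mono F"
    and add_1: "F (x + 1) = F x + 1"
begin

lemma funpow_add_1: "(F ^^ n) (x + 1) = (F ^^ n) x + 1"
  by (induction n) (auto simp: add_1)

lemma funpow_add_of_nat: "(F ^^ n) (x + real k) = (F ^^ n) x + real k"
proof (induction k)
  case (Suc k)
  have "(F ^^ n) (x + real (Suc k)) = (F ^^ n) ((x + real k) + 1)" by (simp add: algebra_simps)
  also have "\<dots> = (F ^^ n) x + real k + 1" by (simp only: funpow_add_1 Suc)
  finally show ?case by simp
qed simp

lemma funpow_add_of_int: "(F ^^ n) (x + of_int k) = (F ^^ n) x + of_int k"
proof (cases k rule: int_cases2)
  case (nonneg m)
  then show ?thesis using funpow_add_of_nat by simp
next
  case (nonpos m)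
  then show ?thesis using funpow_add_of_nat[of n "x - real m" m] by simp
qed

lemma mono_funpow: "mono (F ^^ n)"
  using mono by (rule mono_pow)

lemma continuous_on_funpow: "continuous_on A (F ^^ n)"
proof -
  have "continuous_on UNIV (F ^^ n)"
  proof (induction n)
    case (Suc n)
    then show ?case using cont by (auto intro: continuous_on_compose2)
  qed (simp add: id_def)
  then show ?thesis by (rule continuous_on_subset) simp
qed

text \<open>Compare \<open>x\<close> with its neighbouring integers, where the displacement equals
  that at 0.\<close>

lemma displacement_close: "\<bar>((F ^^ n) x - x) - (F ^^ n) 0\<bar> \<le> 1"
proof -
  let ?k = "\<lfloor>x\<rfloor>"
  have "(F ^^ n) (0 + of_int ?k) \<le> (F ^^ n) x"
    by (rule monoD[OF mono_funpow]) auto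
  moreover have "(F ^^ n) x \<le> (F ^^ n) (0 + of_int (?k + 1))"
    by (rule monoD[OF mono_funpow]) linarith
  ultimately show ?thesis unfolding funpow_add_of_int by linarith
qed

lemma funpow_mult_close: "\<bar>(F ^^ (m * n)) 0 - real m * (F ^^ n) 0\<bar> \<le> real m"
proof (induction m)
  case (Suc m)
  have "(F ^^ (Suc m * n)) 0 = (F ^^ n) ((F ^^ (m * n)) 0)" by (simp add: funpow_add)
  with displacement_close[of n "(F ^^ (m * n)) 0"] Suc show ?case by (simp add: algebra_simps)
qed simp

text \<open>The quotients at \<open>m\<close> and \<open>n\<close> are both compared with the
  quotient at \<open>m * n\<close>. Without convergence, the \<open>lim\<close> in
  \<open>rot_num\<close> would carry no information.\<close>

lemma convergent_rotation: "convergent (\<lambda>n. (F ^^ n) 0 / real n)"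
proof -
  have half: "\<bar>(F ^^ (m * n)) 0 / real (m * n) - (F ^^ n) 0 / real n\<bar> \<le> 1 / real n"
    if "m > 0" "n > 0" for m n
  proof -
    have "(F ^^ (m * n)) 0 / real (m * n) - (F ^^ n) 0 / real n
        = ((F ^^ (m * n)) 0 - real m * (F ^^ n) 0) / real (m * n)"
      using that by (simp add: field_simps)
    then have "\<bar>(F ^^ (m * n)) 0 / real (m * n) - (F ^^ n) 0 / real n\<bar> \<le> real m / real (m * n)"
      using funpow_mult_close[of m n] by (simp only: abs_divide abs_of_nat) (intro divide_right_mono, auto)
    then show ?thesis using that by simp
  qed
  have diff: "\<bar>(F ^^ m) 0 / real m - (F ^^ n) 0 / real n\<bar> \<le> 1 / real m + 1 / real n"
    if "m > 0" "n > 0" for m n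
    using half[OF that] half[OF that(2,1)] by (simp add: mult.commute)
  have "Cauchy (\<lambda>n. (F ^^ n) 0 / real n)"
  proof (rule metric_CauchyI)
    fix e :: real assume "e > 0"
    obtain N where N: "N > 0" "1 / real N < e / 2"
      using \<open>e > 0\<close> by (metis half_gt_zero nat_approx_posE zero_less_Suc)
    show "\<exists>M. \<forall>m\<ge>M. \<forall>n\<ge>M. dist ((F ^^ m) 0 / real m) ((F ^^ n) 0 / real n) < e"
    proof (intro exI[of _ N] allI impI)
      fix m n assume mn: "m \<ge> N" "n \<ge> N"
      have "1 / real m \<le> 1 / real N" "1 / real n \<le> 1 / real N"
        using mn N(1) by (auto intro!: divide_left_mono)
      with diff[of m n] mn N show "dist ((F ^^ m) 0 / real m) ((F ^^ n) 0 / real n) < e"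
        by (simp add: dist_real_def)
    qed
  qed
  then show ?thesis by (rule Cauchy_convergent)
qed

text \<open>Strictness survives the limit because the displacement of \<open>F ^^ q\<close> is
  continuous and periodic: it attains a maximum \<open>D < p\<close>, and the rotation number is at
  most \<open>D / q\<close>.\<close>

lemma rotation_less:
  assumes "q > 0" and less: "\<And>x. (F ^^ q) x < x + p"
  shows "lim (\<lambda>n. (F ^^ n) 0 / real n) < p / real q"
proof -
  have "\<exists>x\<in>{0..1}. \<forall>y\<in>{0..1}. (F ^^ q) y - y \<le> (F ^^ q) x - x"
    by (intro continuous_attains_sup continuous_intros continuous_on_funpow) auto
  then obtain z where z: "\<And>y. y \<in> {0..1} \<Longrightarrow> (F ^^ q) y - y \<le> (F ^^ q) z - z" by blast
  define D where "D = (F ^^ q) z - z"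
  have D: "(F ^^ q) x \<le> x + D" for x
  proof -
    have "frac x \<in> {0..1}" using frac_lt_1[of x] by simp
    from z[OF this] show ?thesis
      using funpow_add_of_int[of q "frac x" "\<lfloor>x\<rfloor>"] by (simp add: D_def frac_def)
  qed
  have Dn: "(F ^^ (n * q)) 0 \<le> real n * D" for n
  proof (induction n)
    case (Suc n)
    have "(F ^^ (Suc n * q)) 0 = (F ^^ q) ((F ^^ (n * q)) 0)" by (simp add: funpow_add)
    also have "\<dots> \<le> real n * D + D" using D Suc add_mono by (meson add_right_mono order_trans)
    finally show ?case by (simp add: algebra_simps)
  qed simp
  define L where "L = lim (\<lambda>n. (F ^^ n) 0 / real n)"
  have "(\<lambda>n. (F ^^ n) 0 / real n) \<longlonglongrightarrow> L"
    using convergent_rotation by (simp add: L_def convergent_LIMSEQ_iff)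
  \<comment> \<open>The limit exists, so it may be computed along the multiples of \<open>q\<close>,
    where \<open>Dn\<close> applies.\<close>
  then have "((\<lambda>n. (F ^^ n) 0 / real n) \<circ> (\<lambda>n. n * q)) \<longlonglongrightarrow> L"
    by (rule LIMSEQ_subseq_LIMSEQ) (use assms(1) in \<open>auto simp: strict_mono_def\<close>)
  moreover have "((\<lambda>n. (F ^^ n) 0 / real n) \<circ> (\<lambda>n. n * q)) n \<le> D / real q" if "n \<ge> 1" for n
    using Dn[of n] that assms(1) by (simp add: field_simps)
  ultimately have "L \<le> D / real q" by (intro LIMSEQ_le_const2) blast+
  also have "\<dots> < p / real q" using less[of z] assms(1) by (simp add: D_def divide_strict_right_mono)
  finally show ?thesis by (simp add: L_def)
qed

end

lemma rot_num_triangle_less: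
  assumes "norm P < 1" "norm Q < 1" "norm R < 1" "\<And>x. (tri P Q R ^^ 5) x < x + 2"
  shows "rot_num (psi (convex hull {P, Q, R})) < 2 / 5"
proof -
  interpret circle_map_lift "tri P Q R"
    using continuous_on_tri[OF assms(1-3)] tri_strict_mono[OF assms(1-3)] tri_add_1
    by unfold_locales (auto intro!: strict_mono_mono strict_monoI)
  show ?thesis
    using rotation_less[of 5 2] assms(4) by (simp add: rot_num_def circle_lift_triangle[OF assms(1-3)])
qed

subsection \<open>Half-turns in the Klein model\<close>

text \<open>With \<open>X = (P, 1)\<close> and \<open>Y = (A, 1)\<close> in Lorentzian space this is the projectivisation of
  \<open>X \<mapsto> 2 \<langle>X, Y\<rangle> Y / \<langle>Y, Y\<rangle> - X\<close>.\<close>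

definition half_turn :: "complex \<Rightarrow> complex \<Rightarrow> complex" where
  "half_turn A P = ((2 * (1 - A \<bullet> P)) *\<^sub>R A - (1 - A \<bullet> A) *\<^sub>R P) /\<^sub>R (2 * (1 - A \<bullet> P) - (1 - A \<bullet> A))"

text \<open>The square of \<open>cosh (dK P Q)\<close>, see \<open>cosh_double_dK\<close> below.\<close>

definition cosh_sq :: "complex \<Rightarrow> complex \<Rightarrow> real" where
  "cosh_sq P Q = (1 - P \<bullet> Q)\<^sup>2 / ((1 - P \<bullet> P) * (1 - Q \<bullet> Q))"

lemma norm_less_1_iff: "norm (P :: complex) < 1 \<longleftrightarrow> P \<bullet> P < 1"
  by (simp add: norm_eq_sqrt_inner)

lemma one_minus_inner_pos:
  assumes "norm (P :: complex) < 1" "norm Q < 1"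
  shows "1 - P \<bullet> Q > 0"
proof -
  have "P \<bullet> Q \<le> norm P * norm Q" by (rule norm_cauchy_schwarz)
  also have "\<dots> \<le> norm P * 1" using assms by (intro mult_left_mono) auto
  also have "\<dots> < 1" using assms by simp
  finally show ?thesis by simp
qed

lemma half_turn_denom_pos:
  assumes "norm (P :: complex) < 1"
  shows "2 * (1 - A \<bullet> P) - (1 - A \<bullet> A) > 0"
proof -
  have "2 * (1 - A \<bullet> P) - (1 - A \<bullet> A) = (A - P) \<bullet> (A - P) + (1 - P \<bullet> P)"
    by (simp add: inner_simps inner_commute)
  then show ?thesis using assms unfolding norm_less_1_iff by (smt (verit) inner_ge_zero)
qed

text \<open>Up to sign, \<open>1 - P \<bullet> Q\<close> is the Lorentz product of
  \<open>(P, 1)\<close> and \<open>(Q, 1)\<close>, which a half-turn preserves. The square comes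
  from clearing the denominator \<open>1 - A \<bullet> A\<close>, the two divisors from rescaling
  the last coordinate to 1.\<close>

lemma one_minus_half_turn_inner_half_turn:
  assumes "norm P < 1" "norm Q < 1"
  shows "1 - half_turn A P \<bullet> half_turn A Q = (1 - A \<bullet> A)\<^sup>2 * (1 - P \<bullet> Q)
    / ((2 * (1 - A \<bullet> P) - (1 - A \<bullet> A)) * (2 * (1 - A \<bullet> Q) - (1 - A \<bullet> A)))"
proof -
  define d where "d Z = 2 * (1 - A \<bullet> Z) - (1 - A \<bullet> A)" for Z
  define v where "v Z = (2 * (1 - A \<bullet> Z)) *\<^sub>R A - (1 - A \<bullet> A) *\<^sub>R Z" for Z
  have ht: "half_turn A Z = v Z /\<^sub>R d Z" for Z by (simp add: half_turn_def v_def d_def)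
  have pos: "d P > 0" "d Q > 0" using half_turn_denom_pos assms by (auto simp: d_def)
  have "d P * d Q - v P \<bullet> v Q = (1 - A \<bullet> A)\<^sup>2 * (1 - P \<bullet> Q)"
    by (simp add: d_def v_def inner_simps inner_commute[of P A] power2_eq_square algebra_simps)
  moreover have "1 - half_turn A P \<bullet> half_turn A Q = (d P * d Q - v P \<bullet> v Q) / (d P * d Q)"
    using pos by (simp add: ht field_simps)
  ultimately show ?thesis by (simp add: d_def)
qed

lemma norm_half_turn:
  assumes "norm A < 1" "norm P < 1"
  shows "norm (half_turn A P) < 1"
proof -
  have "1 - half_turn A P \<bullet> half_turn A P > 0"
    unfolding one_minus_half_turn_inner_half_turn[OF assms(2) assms(2)]
    using half_turn_denom_pos[OF assms(2), of A] assms unfolding norm_less_1_iff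
    by (intro divide_pos_pos mult_pos_pos) auto
  then show ?thesis by (simp add: norm_less_1_iff)
qed

lemma cosh_sq_half_turn:
  assumes "norm A < 1" "norm P < 1" "norm Q < 1"
  shows "cosh_sq (half_turn A P) (half_turn A Q) = cosh_sq P Q"
proof -
  have *: "(N\<^sup>2 * x / (a * b))\<^sup>2 / (N\<^sup>2 * y / (a * a) * (N\<^sup>2 * z / (b * b))) = x\<^sup>2 / (y * z)"
    if "N > 0" "a > 0" "b > 0" for N a b x y z :: real
    using that by (simp add: power_mult_distrib power_divide power2_eq_square)
  show ?thesis
    unfolding cosh_sq_def one_minus_half_turn_inner_half_turn[OF assms(2,3)] one_minus_half_turn_inner_half_turn[OF assms(2,2)]
      one_minus_half_turn_inner_half_turn[OF assms(3,3)]
    using assms half_turn_denom_pos by (intro *) (auto simp: norm_less_1_iff)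
qed

lemma half_turn_half_turn:
  assumes "norm A < 1" "norm P < 1"
  shows "half_turn A (half_turn A P) = P"
proof -
  define k N where kN: "k = 1 - A \<bullet> P" "N = 1 - A \<bullet> A"
  have pos: "2 * k - N > 0" "N > 0"
    using half_turn_denom_pos[OF assms(2)] assms(1) unfolding kN norm_less_1_iff by auto
  have r: "half_turn A P = ((2 * k) *\<^sub>R A - N *\<^sub>R P) /\<^sub>R (2 * k - N)"
    by (simp add: half_turn_def kN)
  have "A \<bullet> ((2 * k) *\<^sub>R A - N *\<^sub>R P) = 2 * k * (1 - N) - N * (1 - k)"
    by (simp add: inner_simps kN)
  then have "A \<bullet> half_turn A P = (2 * k * (1 - N) - N * (1 - k)) / (2 * k - N)"
    unfolding r by (simp add: divide_inverse mult.commute)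
  then have k': "1 - A \<bullet> half_turn A P = k * N / (2 * k - N)"
    using pos by (simp add: field_simps)
  have d': "2 * (k * N / (2 * k - N)) - N = N\<^sup>2 / (2 * k - N)"
    using pos by (simp add: field_simps power2_eq_square)
  have "half_turn A (half_turn A P) = ((2 * (k * N / (2 * k - N))) *\<^sub>R A - N *\<^sub>R half_turn A P) /\<^sub>R (N\<^sup>2 / (2 * k - N))"
    by (simp only: half_turn_def[of A "half_turn A P"] k' kN(2)[symmetric] d')
  also have "(2 * (k * N / (2 * k - N))) *\<^sub>R A - N *\<^sub>R half_turn A P = (N\<^sup>2 / (2 * k - N)) *\<^sub>R P"
    unfolding r by (simp add: scaleR_diff_right power2_eq_square divide_inverse mult_ac)
  also have "\<dots> /\<^sub>R (N\<^sup>2 / (2 * k - N)) = P" using pos by simp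
  finally show ?thesis .
qed

text \<open>A half-turn is projective: numerator \<open>v\<close> and denominator \<open>d\<close>
  are affine in the point, so the parameter \<open>t\<close> on the line becomes
  \<open>t * d Q / d S\<close>.\<close>

lemma on_line_half_turn:
  assumes "norm A < 1" "norm P < 1" "norm Q < 1" "norm S < 1" "on_line P Q S"
  shows "on_line (half_turn A P) (half_turn A Q) (half_turn A S)"
proof -
  define d where "d Z = 2 * (1 - A \<bullet> Z) - (1 - A \<bullet> A)" for Z
  define v where "v Z = (2 * (1 - A \<bullet> Z)) *\<^sub>R A - (1 - A \<bullet> A) *\<^sub>R Z" for Z
  have ht: "half_turn A Z = v Z /\<^sub>R d Z" for Z by (simp add: half_turn_def v_def d_def)
  have pos: "d P > 0" "d Q > 0" "d S > 0" using half_turn_denom_pos assms by (auto simp: d_def)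
  obtain t where S: "S = P + t *\<^sub>R (Q - P)"
    using assms(5) by (auto simp: on_line_def scaleR_conv_of_real)
  have dS: "d S = (1 - t) * d P + t * d Q" by (simp add: d_def S inner_simps algebra_simps)
  have vS: "v S = (1 - t) *\<^sub>R v P + t *\<^sub>R v Q"
    by (simp add: v_def S inner_simps algebra_simps)
  have vPQ: "v P = d P *\<^sub>R half_turn A P" "v Q = d Q *\<^sub>R half_turn A Q" using pos by (auto simp: ht)
  have c: "(1 - t) * d P / d S = 1 - t * d Q / d S" using pos dS by (simp add: field_simps)
  have "half_turn A S = ((1 - t) * d P / d S) *\<^sub>R half_turn A P + (t * d Q / d S) *\<^sub>R half_turn A Q"
    unfolding ht[of S] vS vPQ by (simp add: scaleR_add_right divide_inverse mult.commute)
  also have "\<dots> = half_turn A P + (t * d Q / d S) *\<^sub>R (half_turn A Q - half_turn A P)"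
    unfolding c by (simp add: algebra_simps)
  finally show ?thesis unfolding on_line_def scaleR_conv_of_real by blast
qed

text \<open>Conjugating the half-turn about \<open>P\<close> by the one about \<open>A\<close> gives
  the half-turn about the image of \<open>P\<close>. The extra 1 appears because
  \<open>turn A\<close> inverts itself only up to a shift by 1.\<close>

lemma turn_half_turn:
  assumes "norm A < 1" "norm P < 1"
  shows "turn A (turn P (turn A x)) = turn (half_turn A P) x + 1"
proof -
  define \<kappa> where "\<kappa> = 2 * (1 - A \<bullet> P) - (1 - A \<bullet> A)"
  have \<kappa>: "\<kappa> > 0" using half_turn_denom_pos[OF assms(2)] by (simp add: \<kappa>_def)
  define u where "u = cis (pi * x)"
  obtain a where a: "a > 0" "cis (pi * turn A x) = of_real a * (\<i> * (u - A * cnj u))"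
    using cis_turn[OF assms(1), of x] unfolding u_def by blast
  obtain b where b: "b > 0" "cis (pi * turn P (turn A x)) = of_real b * (\<i> * (cis (pi * turn A x) - P * cnj (cis (pi * turn A x))))"
    using cis_turn[OF assms(2)] by blast
  obtain c where c: "c > 0" "cis (pi * turn (half_turn A P) x) = of_real c * (\<i> * (u - half_turn A P * cnj u))"
    using cis_turn[OF norm_half_turn[OF assms], of x] unfolding u_def by blast
  have \<kappa>r: "of_real \<kappa> * half_turn A P = 2 * A - P - cnj P * A\<^sup>2"
  proof -
    have "of_real \<kappa> * half_turn A P = (2 * (1 - A \<bullet> P)) *\<^sub>R A - (1 - A \<bullet> A) *\<^sub>R P"
      unfolding half_turn_def \<kappa>_def[symmetric] scaleR_conv_of_real[symmetric] using \<kappa> by simp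
    then show ?thesis
      by (simp add: complex_eq_iff inner_complex_def power2_eq_square algebra_simps)
  qed
  have \<kappa>e: "of_real \<kappa> = 1 - P * cnj A - A * cnj P + A * cnj A"
    by (simp add: \<kappa>_def complex_eq_iff inner_complex_def algebra_simps)
  have "\<i> * (cis (pi * turn P (turn A x)) - A * cnj (cis (pi * turn P (turn A x))))
      = - of_real (a * b) * (\<i> * (of_real \<kappa> * u - (2 * A - P - cnj P * A\<^sup>2) * cnj u))"
    unfolding b a \<kappa>e by (simp add: algebra_simps power2_eq_square)
  also have "\<dots> = - of_real (a * b * \<kappa> / c) * cis (pi * turn (half_turn A P) x)"
    unfolding c \<kappa>r[symmetric] using c(1) by (simp add: algebra_simps)
  finally have e: "\<i> * (cis (pi * turn P (turn A x)) - A * cnj (cis (pi * turn P (turn A x))))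
      = - of_real (a * b * \<kappa> / c) * cis (pi * turn (half_turn A P) x)" .
  let ?y = "turn A (turn P (turn A x))" and ?z = "turn (half_turn A P) x"
  obtain d where d: "d > 0" "cis (pi * ?y) = of_real d * (\<i> * (cis (pi * turn P (turn A x)) - A * cnj (cis (pi * turn P (turn A x)))))"
    using cis_turn[OF assms(1)] by blast
  have "Im (cnj (cis (pi * ?z)) * cis (pi * ?y))
      = Im (- of_real (d * (a * b * \<kappa> / c)) * (cnj (cis (pi * ?z)) * cis (pi * ?z)))"
    unfolding d e by (simp add: algebra_simps)
  also have "\<dots> = 0" by (simp add: cis_cnj cis_mult)
  finally have "sin (pi * (?y - ?z)) = 0" by (simp only: Im_cnj_cis)
  then have "sin (pi * (?y - (?z + 1))) = 0" by (simp add: algebra_simps sin_diff sin_add cos_add)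
  \<comment> \<open>The vanishing sine determines \<open>?y - ?z\<close> only up to integers;
    \<open>?y\<close> and \<open>?z + 1\<close> both lying between \<open>x + 1\<close> and
    \<open>x + 2\<close> settles which one.\<close>
  moreover have "x + 1 < ?y" "?y < x + 2"
  proof -
    have "turn A (turn A x) < ?y" by (intro turn_strict_mono turn_bounds assms)
    then show "x + 1 < ?y" by (simp add: turn_turn assms)
    have "?y < turn A (turn A x + 1)" by (intro turn_strict_mono turn_bounds assms)
    then show "?y < x + 2" by (simp add: turn_add_1 turn_turn assms)
  qed
  moreover have "x < ?z" "?z < x + 1" by (intro turn_bounds norm_half_turn assms)+
  ultimately show ?thesis using zero_if_sin_pi_zero[of "?y - (?z + 1)"] by force
qed

lemma tri_half_turn:
  assumes "norm A < 1" "norm P < 1" "norm Q < 1" "norm R < 1"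
  shows "tri P Q R (turn A x) = turn A (tri (half_turn A P) (half_turn A Q) (half_turn A R) x)"
proof -
  have "mono (turn A)"
    by (intro strict_mono_mono strict_monoI turn_strict_mono assms)
  then have "turn A (tri P Q R (turn A x)) = tri (half_turn A P) (half_turn A Q) (half_turn A R) x + 1"
    unfolding tri_def by (simp add: turn_half_turn assms flip: min_of_mono)
  then have "turn A (turn A (tri P Q R (turn A x))) = turn A (tri (half_turn A P) (half_turn A Q) (half_turn A R) x + 1)"
    by simp
  then show ?thesis by (simp add: turn_turn[OF assms(1)] turn_add_1)
qed

lemma tri_rotate:
  "tri (P * cis (2 * pi * \<theta>)) (Q * cis (2 * pi * \<theta>)) (R * cis (2 * pi * \<theta>)) (x + \<theta>) = tri P Q R x + \<theta>"
  by (simp add: tri_def turn_rotate min_def)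

lemma tri_funpow_half_turn:
  assumes "norm A < 1" "norm P < 1" "norm Q < 1" "norm R < 1"
    and less: "\<And>x. (tri (half_turn A P) (half_turn A Q) (half_turn A R) ^^ 5) x < x + 2"
  shows "(tri P Q R ^^ 5) x < x + 2"
proof -
  have conj: "(tri P Q R ^^ n) (turn A y) = turn A ((tri (half_turn A P) (half_turn A Q) (half_turn A R) ^^ n) y)" for n y
    by (induction n) (auto simp: tri_half_turn assms)
  \<comment> \<open>Subtracting 1 compensates the shift in \<open>turn_turn\<close>, so that
    \<open>turn A y = x\<close>.\<close>
  define y where "y = turn A (x - 1)"
  have "x = turn A y" by (simp add: y_def turn_turn assms)
  then have "(tri P Q R ^^ 5) x < turn A (y + 1 + 1)"
    using conj less turn_strict_mono[OF assms(1)] by (simp add: add.assoc)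
  also have "\<dots> = x + 2" unfolding turn_add_1 \<open>x = turn A y\<close> by simp
  finally show ?thesis .
qed

lemma tri_funpow_rotate:
  assumes less: "\<And>x. (tri (P * cis (2 * pi * \<theta>)) (Q * cis (2 * pi * \<theta>)) (R * cis (2 * pi * \<theta>)) ^^ 5) x < x + 2"
  shows "(tri P Q R ^^ 5) x < x + 2"
proof -
  have "(tri (P * cis (2 * pi * \<theta>)) (Q * cis (2 * pi * \<theta>)) (R * cis (2 * pi * \<theta>)) ^^ n) (x + \<theta>) = (tri P Q R ^^ n) x + \<theta>" for n
    by (induction n) (auto simp: tri_rotate)
  from this[of 5] less[of "x + \<theta>"] show ?thesis by simp
qed

subsection \<open>The distance in the Klein model\<close>

lemma on_line_sphere_iff:
  assumes "v = P + of_real t * (Q - P)"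
  shows "v \<in> sphere 0 1 \<longleftrightarrow> (Q - P) \<bullet> (Q - P) * t\<^sup>2 + 2 * (P \<bullet> (Q - P)) * t + (P \<bullet> P - 1) = 0"
proof -
  have v: "v = P + t *\<^sub>R (Q - P)" by (simp add: assms scaleR_conv_of_real)
  have "v \<bullet> v = (Q - P) \<bullet> (Q - P) * t\<^sup>2 + 2 * (P \<bullet> (Q - P)) * t + P \<bullet> P"
    unfolding v inner_add_left inner_add_right inner_scaleR_left inner_scaleR_right
    by (simp add: inner_commute[of "Q - P" P] power2_eq_square distrib_left mult_ac)
  moreover have "v \<in> sphere 0 1 \<longleftrightarrow> v \<bullet> v = 1" by (simp add: norm_eq_1)
  ultimately show ?thesis by auto
qed

text \<open>Since \<open>P\<close> is inside the circle, the quadratic for the ends has positive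
  leading and negative constant coefficient, hence two real roots; so the choice in
  \<open>chord_ends\<close> has a witness.\<close>

lemma chord_ends_ends:
  assumes "norm P < 1" "P \<noteq> Q" "chord_ends P Q = (v1, v2)"
  shows "v1 \<noteq> v2" "v1 \<in> sphere 0 1" "v2 \<in> sphere 0 1" "on_line P Q v1" "on_line P Q v2"
proof -
  have a: "(Q - P) \<bullet> (Q - P) > 0" using assms(2) by simp
  have c: "P \<bullet> P - 1 < 0" using assms(1) by (simp add: norm_less_1_iff)
  have "discrim ((Q - P) \<bullet> (Q - P)) (2 * (P \<bullet> (Q - P))) (P \<bullet> P - 1) > 0"
    using mult_pos_neg[OF a c] zero_le_power2[of "2 * (P \<bullet> (Q - P))"] unfolding discrim_def by linarith
  then obtain s t where st: "s \<noteq> t"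
    "(Q - P) \<bullet> (Q - P) * s\<^sup>2 + 2 * (P \<bullet> (Q - P)) * s + (P \<bullet> P - 1) = 0"
    "(Q - P) \<bullet> (Q - P) * t\<^sup>2 + 2 * (P \<bullet> (Q - P)) * t + (P \<bullet> P - 1) = 0"
    using discriminant_pos_ex a by (metis less_irrefl)
  let ?e = "\<lambda>t. P + of_real t * (Q - P)"
  have "?e s \<noteq> ?e t" using st(1) assms(2) by simp
  moreover have "?e s \<in> sphere 0 1" "?e t \<in> sphere 0 1" using st on_line_sphere_iff by blast+
  moreover have "on_line P Q (?e s)" "on_line P Q (?e t)" unfolding on_line_def by blast+
  ultimately have "\<exists>p. case p of (v1, v2) \<Rightarrow> v1 \<noteq> v2 \<and> v1 \<in> sphere 0 1 \<and> v2 \<in> sphere 0 1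
        \<and> on_line P Q v1 \<and> on_line P Q v2" by blast
  then have "case chord_ends P Q of (v1, v2) \<Rightarrow> v1 \<noteq> v2 \<and> v1 \<in> sphere 0 1 \<and> v2 \<in> sphere 0 1
        \<and> on_line P Q v1 \<and> on_line P Q v2"
    unfolding chord_ends_def by (rule someI_ex)
  then show "v1 \<noteq> v2" "v1 \<in> sphere 0 1" "v2 \<in> sphere 0 1" "on_line P Q v1" "on_line P Q v2"
    using assms(3) by auto
qed

lemma dK_nonneg: "dK P Q \<ge> 0"
  by (auto simp: dK_def split: prod.split)

text \<open>If the chord ends have parameters \<open>s\<close> and \<open>t\<close> on the line from
  \<open>P\<close> to \<open>Q\<close>, the cross ratio is \<open>p / q\<close> with
  \<open>p = (1 - s) * t\<close> and \<open>q = s * (1 - t)\<close>. The hyperbolic cosine is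
  symmetric in \<open>p\<close> and \<open>q\<close>, so Vieta's formulas suffice and the order of
  the chosen ends does not matter.\<close>

lemma cosh_double_dK:
  assumes "norm P < 1" "norm Q < 1"
  shows "cosh (2 * dK P Q) = 2 * cosh_sq P Q - 1"
proof (cases "P = Q")
  case True
  then show ?thesis using one_minus_inner_pos[OF assms(1,1)]
    by (simp add: dK_def cosh_sq_def power2_eq_square)
next
  case False
  define a b c where abc: "a = (Q - P) \<bullet> (Q - P)" "b = 2 * (P \<bullet> (Q - P))" "c = P \<bullet> P - 1"
  have a: "a > 0" using False by (simp add: abc)
  obtain v1 v2 where v: "chord_ends P Q = (v1, v2)" by fastforce
  note ends = chord_ends_ends[OF assms(1) False v]
  obtain s where s: "v1 = P + of_real s * (Q - P)" using ends by (auto simp: on_line_def)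
  obtain t where t: "v2 = P + of_real t * (Q - P)" using ends by (auto simp: on_line_def)
  have eq: "a * s\<^sup>2 + b * s + c = 0" "a * t\<^sup>2 + b * t + c = 0"
    using ends(2,3) on_line_sphere_iff[OF s] on_line_sphere_iff[OF t] by (simp_all add: abc)
  have st: "s \<noteq> t" using ends(1) s t by auto
  have "(s - t) * (a * (s + t) + b) = 0" using eq by (simp add: algebra_simps power2_eq_square)
  then have sum: "a * (s + t) = - b" using st by simp
  have prod: "a * (s * t) = c"
  proof -
    have "a * (s * t) = a * (s + t) * s - a * s\<^sup>2" by (simp add: algebra_simps power2_eq_square)
    then show ?thesis using sum eq(1) by simp
  qed
  have prod': "a * ((1 - s) * (1 - t)) = a + b + c" using sum prod by (simp add: algebra_simps)
  define p q where pq: "p = (1 - s) * t" "q = s * (1 - t)"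
  have sumpq: "a * (p + q) = 2 * (1 - P \<bullet> Q)"
  proof -
    have "a * (p + q) = a * (s + t) - 2 * (a * (s * t))" by (simp add: pq algebra_simps)
    also have "\<dots> = - b - 2 * c" by (simp only: sum prod)
    also have "\<dots> = 2 * (1 - P \<bullet> Q)" by (simp add: abc inner_simps)
    finally show ?thesis .
  qed
  have "a\<^sup>2 * (p * q) = (a * (s * t)) * (a * ((1 - s) * (1 - t)))"
    by (simp add: pq power2_eq_square algebra_simps)
  also have "\<dots> = (1 - P \<bullet> P) * (1 - Q \<bullet> Q)"
    by (simp add: prod prod') (simp add: abc inner_simps inner_commute algebra_simps)
  finally have prodpq: "a\<^sup>2 * (p * q) = (1 - P \<bullet> P) * (1 - Q \<bullet> Q)" .
  then have "p * q > 0"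
    using assms a unfolding norm_less_1_iff by (metis diff_gt_0_iff_gt zero_less_mult_pos mult_pos_pos zero_less_power)
  then have Y: "p / q > 0" "p \<noteq> 0" "q \<noteq> 0" by (auto simp: zero_less_divide_iff zero_less_mult_iff)
  have norms: "cmod (Q - v1) = \<bar>1 - s\<bar> * cmod (Q - P)" "cmod (P - v1) = \<bar>s\<bar> * cmod (Q - P)"
    "cmod (Q - v2) = \<bar>1 - t\<bar> * cmod (Q - P)" "cmod (P - v2) = \<bar>t\<bar> * cmod (Q - P)"
  proof -
    have "Q - v1 = of_real (1 - s) * (Q - P)" "P - v1 = of_real (- s) * (Q - P)"
      "Q - v2 = of_real (1 - t) * (Q - P)" "P - v2 = of_real (- t) * (Q - P)"
      by (simp_all add: s t algebra_simps)
    then show "cmod (Q - v1) = \<bar>1 - s\<bar> * cmod (Q - P)" "cmod (P - v1) = \<bar>s\<bar> * cmod (Q - P)"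
    "cmod (Q - v2) = \<bar>1 - t\<bar> * cmod (Q - P)" "cmod (P - v2) = \<bar>t\<bar> * cmod (Q - P)"
      by (simp_all only: norm_mult norm_of_real abs_minus_cancel)
  qed
  have "(cmod (Q - v1) * cmod (P - v2)) / (cmod (P - v1) * cmod (Q - v2)) = \<bar>p / q\<bar>"
    unfolding norms pq using False by (simp add: abs_mult)
  then have "2 * dK P Q = \<bar>ln (p / q)\<bar>"
    using False v Y(1) unfolding dK_def by (simp only: if_False Let_def prod.case abs_of_pos)
  then have "cosh (2 * dK P Q) = (p / q + inverse (p / q)) / 2"
    using Y(1) by (simp add: cosh_ln_real del: inverse_divide)
  also have "\<dots> = (a * (p + q))\<^sup>2 / (2 * (a\<^sup>2 * (p * q))) - 1"
    using Y a by (simp add: field_simps power2_eq_square)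
  also have "\<dots> = 2 * cosh_sq P Q - 1"
    unfolding sumpq prodpq cosh_sq_def power_mult_distrib by simp
  finally show ?thesis .
qed

subsection \<open>Isometry-invariant hypotheses\<close>

text \<open>The hypotheses in a form visibly invariant under isometries, with \<open>l = exp (dK P Q)\<close>: since
  \<open>exp (DeltaK 1 P Q) = (l + 1)/(l - 1)\<close>, the last clause says \<open>cosh (2 * dK R S) > cosh (DeltaK 1 P Q)\<close>.\<close>

definition admissible :: "real \<Rightarrow> complex \<Rightarrow> complex \<Rightarrow> complex \<Rightarrow> bool" where
  "admissible l P Q R \<longleftrightarrow> norm P < 1 \<and> norm Q < 1 \<and> norm R < 1 \<and> P \<noteq> Q \<and> l > 9 \<and>
     cosh_sq P R = cosh_sq Q R \<and> (l + 1 / l)\<^sup>2 = 4 * cosh_sq P Q \<and>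
     (\<forall>S. norm S < 1 \<and> on_line P Q S \<longrightarrow> 2 * cosh_sq R S - 1 > (l\<^sup>2 + 1) / (l\<^sup>2 - 1))"

lemma admissible_if_dK:
  assumes "norm P < 1" "norm Q < 1" "norm R < 1" "dK P R = dK Q R" "dK P Q > ln 9"
    and "deltaK P Q R > DeltaK 1 P Q / 2"
  shows "admissible (exp (dK P Q)) P Q R"
proof -
  define l where "l = exp (dK P Q)"
  have l: "l > 9" using assms(5) unfolding l_def by (metis exp_less_cancel_iff exp_ln zero_less_numeral)
  have ll: "l * l > 1" using mult_strict_mono[of 1 l 1 l] l by simp
  have "P \<noteq> Q" using assms(5) by (auto simp: dK_def)
  moreover have "cosh_sq P R = cosh_sq Q R"
    using assms(4) cosh_double_dK[OF assms(1,3)] cosh_double_dK[OF assms(2,3)] by simp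
  moreover have "(l + 1 / l)\<^sup>2 = 4 * cosh_sq P Q"
  proof -
    have "l + 1 / l = 2 * cosh (dK P Q)"
      unfolding cosh_field_def l_def exp_minus by (simp add: inverse_eq_divide)
    then show ?thesis
      using cosh_double_dK[OF assms(1,2)] cosh_double_cosh[of "dK P Q"] by (simp add: power_mult_distrib)
  qed
  moreover have "2 * cosh_sq R S - 1 > (l\<^sup>2 + 1) / (l\<^sup>2 - 1)" if S: "norm S < 1" "on_line P Q S" for S
  proof -
    \<comment> \<open>This is \<open>exp (DeltaK 1 P Q)\<close>; the bound on \<open>deltaK\<close>
      becomes \<open>ln y < 2 * dK R S\<close>, and applying \<open>cosh\<close> removes the
      logarithm.\<close>
    define y where "y = (l + 1) / (l - 1)"
    have y: "y > 1" using l by (simp add: y_def field_simps)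
    have "bdd_below (dK R ` {S \<in> ball 0 1. on_line P Q S})" using dK_nonneg by (intro bdd_belowI) auto
    then have "deltaK P Q R \<le> dK R S" unfolding deltaK_def using S by (intro cInf_lower) auto
    then have "ln y < 2 * dK R S" using assms(6) unfolding DeltaK_def y_def l_def by simp
    moreover have "0 \<le> ln y" using y by simp
    ultimately have "cosh (ln y) < cosh (2 * dK R S)"
      by (subst cosh_real_nonneg_less_iff) auto
    then have "(y + inverse y) / 2 < 2 * cosh_sq R S - 1"
      using y cosh_double_dK[OF assms(3) S(1)] by (simp add: cosh_ln_real)
    moreover have "(y + inverse y) / 2 = (l\<^sup>2 + 1) / (l\<^sup>2 - 1)"
      using l ll by (simp add: y_def power2_eq_square divide_simps) (simp add: algebra_simps)
    ultimately show ?thesis by simp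
  qed
  ultimately show ?thesis using assms l unfolding admissible_def l_def by blast
qed

section \<open>Invariance of the hypotheses and normal form up to isometry\<close>

lemma admissible_half_turn:
  assumes "admissible l P Q R" "norm A < 1"
  shows "admissible l (half_turn A P) (half_turn A Q) (half_turn A R)"
proof -
  have n: "norm P < 1" "norm Q < 1" "norm R < 1" using assms(1) by (auto simp: admissible_def)
  have "2 * cosh_sq (half_turn A R) S - 1 > (l\<^sup>2 + 1) / (l\<^sup>2 - 1)"
    if S: "norm S < 1" "on_line (half_turn A P) (half_turn A Q) S" for S
  proof -
    \<comment> \<open>Points of the new line are pulled back to the old one by the same half-turn,
      which is its own inverse.\<close>
    have nS: "norm (half_turn A S) < 1" using assms S norm_half_turn by blast
    have "on_line P Q (half_turn A S)"
      using on_line_half_turn[OF assms(2) _ _ S(1) S(2)] half_turn_half_turn[OF assms(2)] norm_half_turn[OF assms(2)] n by simp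
    with assms(1) nS have "2 * cosh_sq R (half_turn A S) - 1 > (l\<^sup>2 + 1) / (l\<^sup>2 - 1)"
      by (auto simp: admissible_def)
    then show ?thesis
      using cosh_sq_half_turn[OF assms(2) n(3) nS] half_turn_half_turn[OF assms(2) S(1)] by simp
  qed
  moreover have "half_turn A P \<noteq> half_turn A Q"
    using half_turn_half_turn[OF assms(2) n(1)] half_turn_half_turn[OF assms(2) n(2)] assms(1)
    by (metis admissible_def)
  ultimately show ?thesis
    using assms n by (simp add: admissible_def cosh_sq_half_turn norm_half_turn)
qed

text \<open>The half-turn about the hyperbolic midpoint of 0 and \<open>S\<close> exchanges them; in
  Klein coordinates this midpoint is \<open>S\<close> divided by \<open>1 + s\<close>.\<close>

lemma half_turn_to_0:
  assumes "norm S < 1"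
  obtains A where "norm A < 1" "half_turn A S = 0"
proof -
  define s where "s = sqrt (1 - S \<bullet> S)"
  have s: "s > 0" "S \<bullet> S = 1 - s\<^sup>2" using assms by (auto simp: s_def norm_less_1_iff)
  define A where "A = S /\<^sub>R (1 + s)"
  have AS: "A \<bullet> S = 1 - s"
    using s by (simp add: A_def field_simps power2_eq_square)
  have AA: "1 - A \<bullet> A = 2 * s / (1 + s)"
    using s by (simp add: A_def divide_simps) (simp add: algebra_simps power2_eq_square)
  have "1 - A \<bullet> A > 0" using s AA by simp
  then have "norm A < 1" by (simp add: norm_less_1_iff)
  moreover have "half_turn A S = 0"
    unfolding half_turn_def AS AA using s by (simp add: A_def divide_inverse)
  ultimately show ?thesis using that by blast
qed

text \<open>The vectors \<open>(P, 1) / a\<close> and \<open>(Q, 1) / b\<close> have equal Lorentz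
  norm, and the midpoint is the direction of their sum; this gives the weight
  \<open>t = a / (a + b)\<close>.\<close>

lemma hyperbolic_midpoint:
  assumes "norm P < 1" "norm Q < 1"
  obtains S where "norm S < 1" "on_line P Q S" "cosh_sq P S = cosh_sq Q S"
proof -
  define a b where ab: "a = sqrt (1 - P \<bullet> P)" "b = sqrt (1 - Q \<bullet> Q)"
  have pos: "a > 0" "b > 0" "P \<bullet> P = 1 - a\<^sup>2" "Q \<bullet> Q = 1 - b\<^sup>2"
    using assms by (auto simp: ab norm_less_1_iff)
  define t where "t = a / (a + b)"
  have t: "0 < t" "t < 1" using pos by (auto simp: t_def)
  define S where "S = P + t *\<^sub>R (Q - P)"
  have "S = (1 - t) *\<^sub>R P + t *\<^sub>R Q" by (simp add: S_def algebra_simps)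
  moreover have "(1 - t) *\<^sub>R P + t *\<^sub>R Q \<in> ball 0 1"
    using assms t by (intro convexD[OF convex_ball]) auto
  ultimately have "S \<in> ball 0 1" by simp
  moreover have "on_line P Q S" unfolding S_def on_line_def scaleR_conv_of_real by blast
  moreover have "cosh_sq P S = cosh_sq Q S"
  proof -
    define i where "i = P \<bullet> Q"
    have "1 - P \<bullet> S = a * ((1 - i + a * b) / (a + b))"
      using pos by (simp add: S_def inner_simps i_def t_def divide_simps) (simp add: algebra_simps power2_eq_square)
    moreover have "1 - Q \<bullet> S = b * ((1 - i + a * b) / (a + b))"
      using pos by (simp add: S_def inner_simps i_def t_def inner_commute divide_simps) (simp add: algebra_simps power2_eq_square)
    ultimately show ?thesis
      unfolding cosh_sq_def pos(3,4) power_mult_distrib using pos(1,2)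
      by (simp only: power_mult_distrib) simp
  qed
  ultimately show ?thesis using that by simp
qed

lemma admissible_rotate:
  assumes "admissible l P Q R"
  shows "admissible l (P * cis a) (Q * cis a) (R * cis a)"
proof -
  have inner: "(X * cis a) \<bullet> (Y * cis a) = X \<bullet> Y" for X Y
  proof -
    have "(X * cis a) \<bullet> (Y * cis a) = Re (cnj (X * cis a) * (Y * cis a))"
      by (simp add: inner_complex_def algebra_simps)
    also have "cnj (X * cis a) * (Y * cis a) = cnj X * Y * (cnj (cis a) * cis a)" by simp
    also have "Re \<dots> = X \<bullet> Y" by (simp add: cis_cnj cis_mult inner_complex_def)
    finally show ?thesis .
  qed
  have cs: "cosh_sq (X * cis a) (Y * cis a) = cosh_sq X Y" for X Y
    by (simp add: cosh_sq_def inner)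
  have "2 * cosh_sq (R * cis a) S - 1 > (l\<^sup>2 + 1) / (l\<^sup>2 - 1)"
    if S: "norm S < 1" "on_line (P * cis a) (Q * cis a) S" for S
  proof -
    have S': "S * cis (- a) * cis a = S" by (simp add: mult.assoc cis_mult)
    obtain t where t: "S = P * cis a + of_real t * (Q * cis a - P * cis a)"
      using S by (auto simp: on_line_def)
    have "S * cis (- a) = (P + of_real t * (Q - P)) * (cis a * cis (- a))"
      by (simp only: t) (simp add: algebra_simps)
    then have "on_line P Q (S * cis (- a))" by (auto simp: on_line_def cis_mult)
    moreover have "norm (S * cis (- a)) < 1" using S by (simp add: norm_mult)
    ultimately have "2 * cosh_sq R (S * cis (- a)) - 1 > (l\<^sup>2 + 1) / (l\<^sup>2 - 1)"
      using assms unfolding admissible_def by blast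
    then show ?thesis using cs[of R "S * cis (- a)"] unfolding S' by simp
  qed
  then show ?thesis using assms by (simp add: admissible_def cs norm_mult)
qed

lemma admissible_swap:
  assumes "admissible l P Q R" shows "admissible l Q P R"
proof -
  have "cosh_sq Q P = cosh_sq P Q" by (simp add: cosh_sq_def inner_commute mult.commute)
  moreover have "on_line P Q S" if "on_line Q P S" for S
  proof -
    from that obtain t where "S = Q + of_real t * (P - Q)" by (auto simp: on_line_def)
    then have "S = P + of_real (1 - t) * (Q - P)" by (simp add: algebra_simps)
    then show ?thesis unfolding on_line_def by blast
  qed
  ultimately show ?thesis using assms by (auto simp: admissible_def)
qed

text \<open>Equidistance puts \<open>R\<close> on the imaginary axis, the value of
  \<open>cosh_sq\<close> at \<open>p\<close> and \<open>-p\<close> determines \<open>l\<close>, and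
  the distance bound at 0, the foot of the perpendicular from \<open>R\<close>, becomes
  \<open>l * r > 1\<close>.\<close>

lemma admissible_standard:
  assumes "admissible l (of_real p) (- of_real p) R" "p > 0" "Im R \<ge> 0"
  obtains r where "R = \<i> * of_real r" "p < 1" "l = (1 + p) / (1 - p)" "1 / l < r" "r < 1"
proof -
  have p: "p < 1" and l: "l > 9" and R: "norm R < 1" and l2: "(l + 1 / l)\<^sup>2 = 4 * cosh_sq (of_real p) (- of_real p)"
    and eq: "cosh_sq (of_real p) R = cosh_sq (- of_real p) R"
    and S: "\<And>S. norm S < 1 \<Longrightarrow> on_line (of_real p) (- of_real p) S \<Longrightarrow> 2 * cosh_sq R S - 1 > (l\<^sup>2 + 1) / (l\<^sup>2 - 1)"
    using assms by (auto simp: admissible_def)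
  have pp: "p * p < 1" using mult_strict_mono[of p 1 p 1] p assms(2) by simp
  have "Re R = 0"
  proof -
    have "(1 - p * Re R)\<^sup>2 = (1 + p * Re R)\<^sup>2"
      using eq pp R unfolding norm_less_1_iff by (simp add: cosh_sq_def inner_complex_def)
    then have "p * Re R = 0" by (simp add: power2_eq_square algebra_simps)
    then show ?thesis using assms(2) by simp
  qed
  then have r: "R = \<i> * of_real (Im R)" by (simp add: complex_eq_iff)
  define m where "m = (1 + p) / (1 - p)"
  have m: "m > 1" using p assms(2) by (simp add: m_def field_simps)
  have "(l + 1 / l)\<^sup>2 = (2 * (1 + p * p) / (1 - p * p))\<^sup>2"
    unfolding l2 by (simp add: cosh_sq_def inner_complex_def power_divide power2_eq_square)
      (simp add: algebra_simps)
  moreover have "l + 1 / l > 0" using l by (simp add: add_pos_pos)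
  moreover have "2 * (1 + p * p) / (1 - p * p) > 0" using pp assms(2) by (intro divide_pos_pos mult_pos_pos add_pos_pos) auto
  ultimately have "l + 1 / l = 2 * (1 + p * p) / (1 - p * p)" by (simp add: power2_eq_iff_nonneg)
  also have "\<dots> = m + 1 / m"
  proof -
    have "1 - p * p = (1 - p) * (1 + p)" by (simp add: algebra_simps)
    then show ?thesis using p assms(2) by (simp add: m_def divide_simps) (simp add: algebra_simps)
  qed
  \<comment> \<open>The value \<open>l + 1 / l\<close> determines \<open>l\<close> up to inversion;
    both numbers exceed 1, which leaves \<open>l = m\<close>.\<close>
  finally have "(l - m) * (l * m - 1) = 0" using l m by (simp add: field_simps)
  moreover have "l * m > 1" using l m mult_strict_mono[of 1 l 1 m] by simp
  ultimately have lm: "l = m" by simp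
  define r where "r = Im R"
  have "on_line (of_real p) (- of_real p) 0" unfolding on_line_def by (intro exI[of _ "1/2"]) simp
  then have "(l\<^sup>2 + 1) / (l\<^sup>2 - 1) < 2 * cosh_sq R 0 - 1" using S[of 0] by simp
  also have "cosh_sq R 0 = 1 / (1 - r\<^sup>2)"
    using \<open>Re R = 0\<close> by (simp add: cosh_sq_def inner_complex_def r_def power2_eq_square)
  finally have less: "(l\<^sup>2 + 1) / (l\<^sup>2 - 1) < 2 * (1 / (1 - r\<^sup>2)) - 1" .
  have rr: "r\<^sup>2 < 1" using R \<open>Re R = 0\<close> unfolding norm_less_1_iff by (simp add: inner_complex_def r_def power2_eq_square)
  then have "r < 1" by (simp add: power2_less_1_iff abs_less_iff)
  have "l\<^sup>2 > 1" using l by (simp add: power2_eq_square less_1_mult)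
  have "l\<^sup>2 * r\<^sup>2 > 1"
  proof -
    \<comment> \<open>Both sides of \<open>less\<close> have the form
      \<open>(1 + s) / (1 - s)\<close>, with \<open>s = 1 / l\<^sup>2\<close> and
      \<open>s = r\<^sup>2\<close>, which is increasing for \<open>s < 1\<close>.\<close>
    have "2 * (1 / (1 - r\<^sup>2)) - 1 = (1 + r\<^sup>2) / (1 - r\<^sup>2)" using rr by (simp add: field_simps)
    with less have "(l\<^sup>2 + 1) * (1 - r\<^sup>2) < (1 + r\<^sup>2) * (l\<^sup>2 - 1)"
      using rr \<open>l\<^sup>2 > 1\<close> by (simp add: divide_less_eq less_divide_eq mult.commute frac_less2 divide_simps)
    then show ?thesis by (simp add: algebra_simps)
  qed
  then have "1\<^sup>2 < (l * r)\<^sup>2" by (simp add: power_mult_distrib)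
  moreover have "0 \<le> l * r" using l assms(3) by (simp add: r_def)
  ultimately have "1 < l * r" by (rule power_less_imp_less_base)
  then have "1 / l < r" using l by (simp add: field_simps)
  then show ?thesis using that[of r] r p lm \<open>r < 1\<close> by (simp add: r_def m_def)
qed

subsection \<open>The normalised triangle\<close>

text \<open>The half-angle vector \<open>cis (pi * x)\<close> is a homogeneous coordinate on the boundary in which turns
  act linearly; its sign distinguishes \<open>x\<close> from \<open>x + 1\<close>.\<close>

definition has_dir :: "real \<Rightarrow> real \<Rightarrow> real \<Rightarrow> bool" where
  "has_dir x a b \<longleftrightarrow> (\<exists>c>0. cis (pi * x) = of_real c * Complex a b)"

lemma has_dir_turn:
  assumes "has_dir x a b" "norm Z < 1" "k > 0"
    and "\<i> * (Complex a b - Z * cnj (Complex a b)) = of_real k * Complex a' b'"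
  shows "has_dir (turn Z x) a' b'"
proof -
  obtain c where c: "c > 0" "cis (pi * x) = of_real c * Complex a b"
    using assms(1) by (auto simp: has_dir_def)
  obtain d where d: "d > 0" "cis (pi * turn Z x) = of_real d * (\<i> * (cis (pi * x) - Z * cnj (cis (pi * x))))"
    using cis_turn[OF assms(2)] by blast
  have "cis (pi * turn Z x) = of_real (d * c) * (\<i> * (Complex a b - Z * cnj (Complex a b)))"
    unfolding d(2) c(2) by (simp add: algebra_simps)
  also have "\<dots> = of_real (d * c * k) * Complex a' b'" unfolding assms(4) by simp
  finally show ?thesis unfolding has_dir_def using c(1) d(1) assms(3) by (intro exI[of _ "d * c * k"]) simp
qed

lemma has_dir_add_1: "has_dir x a b \<Longrightarrow> has_dir (x + 1) (- a) (- b)"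
proof -
  assume "has_dir x a b"
  then obtain c where c: "c > 0" "cis (pi * x) = of_real c * Complex a b" by (auto simp: has_dir_def)
  have "cis (pi * (x + 1)) = - cis (pi * x)" by (simp add: distrib_left flip: cis_mult)
  also have "\<dots> = of_real c * Complex (- a) (- b)" by (simp add: c(2) complex_eq_iff)
  finally show ?thesis using c(1) by (auto simp: has_dir_def)
qed

lemma has_dir_sin:
  assumes "has_dir x a b" "has_dir y a' b'"
  obtains k where "k > 0" "sin (pi * (y - x)) = k * (a * b' - b * a')"
proof -
  obtain c d where "c > 0" "d > 0" and cd: "cis (pi * x) = of_real c * Complex a b"
    "cis (pi * y) = of_real d * Complex a' b'"
    using assms by (auto simp: has_dir_def)
  have "sin (pi * (y - x)) = (c * d) * (a * b' - b * a')"
    unfolding Im_cnj_cis[symmetric] cd by (simp add: algebra_simps)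
  then show ?thesis using that[of "c * d"] \<open>c > 0\<close> \<open>d > 0\<close> by simp
qed

text \<open>The determinant gives the sign of the sine of \<open>pi * (y - x)\<close>; the a priori
  bound \<open>y < x + 1\<close> excludes that \<open>y\<close> is more than one turn ahead.\<close>

lemma has_dir_less:
  assumes "has_dir x a b" "has_dir y a' b'" "y < x + 1" "a * b' < b * a'"
  shows "y < x"
proof -
  obtain k where k: "k > 0" "sin (pi * (y - x)) = k * (a * b' - b * a')"
    using has_dir_sin[OF assms(1,2)] by blast
  have "sin (pi * (y - x)) < 0" unfolding k(2) using k(1) assms(4) by (simp add: mult_pos_neg)
  then show ?thesis using neg_if_sin_pi_neg[of "y - x"] assms(3) by simp
qed

lemma has_dir_eq:
  assumes "has_dir x a b" "has_dir y a' b'" "\<bar>y - x\<bar> < 1" "a * b' = b * a'"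
  shows "y = x"
proof -
  obtain k where k: "k > 0" "sin (pi * (y - x)) = k * (a * b' - b * a')"
    using has_dir_sin[OF assms(1,2)] by blast
  then show ?thesis using zero_if_sin_pi_zero[of "y - x"] assms(3,4) by simp
qed

locale standard_triangle =
  fixes p l r :: real
  assumes p: "0 < p" "p < 1" and l_def: "l = (1 + p) / (1 - p)" and l: "l > 9"
    and r: "1 / l < r" "r < 1"
begin

abbreviation "TP \<equiv> turn (of_real p)"
abbreviation "TQ \<equiv> turn (- of_real p)"
abbreviation "TR \<equiv> turn (\<i> * of_real r)"
abbreviation "F \<equiv> tri (of_real p) (- of_real p) (\<i> * of_real r)"

lemma r_pos: "r > 0"
  using r(1) l by (smt (verit) divide_nonneg_pos)

lemma lr: "l * r > 1"
  using r(1) l by (simp add: field_simps)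

lemma l2r2: "l\<^sup>2 * r\<^sup>2 > 1"
  using lr by (metis one_less_power pos2 power_mult_distrib)

lemma norms: "norm (of_real p :: complex) < 1" "norm (- of_real p :: complex) < 1" "norm (\<i> * of_real r) < 1"
  using p r r_pos by (auto simp: norm_mult)

lemmas strict = turn_strict_mono[OF norms(1)] turn_strict_mono[OF norms(2)] turn_strict_mono[OF norms(3)]

lemma TP_mono: "mono TP" and TQ_mono: "mono TQ" and TR_mono: "mono TR"
  using strict by (auto intro!: strict_mono_mono strict_monoI)

lemma l_scale: "(1 - p) * (l * c) = (1 + p) * c"
  using p by (simp add: l_def)

text \<open>A common factor \<open>1 - p\<close> is dropped here and in \<open>dir_TQ\<close>, after
  which \<open>p\<close> enters only through \<open>l\<close>.\<close>

lemma dir_TP: "has_dir x a b \<Longrightarrow> has_dir (TP x) (- (l * b)) a"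
  using p by (erule_tac has_dir_turn[OF _ norms(1), of _ _ _ "1 - p"]) (simp_all add: complex_eq_iff l_scale, simp_all add: algebra_simps)

lemma dir_TQ: "has_dir x a b \<Longrightarrow> has_dir (TQ x) (- b) (l * a)"
  using p by (erule_tac has_dir_turn[OF _ norms(2), of _ _ _ "1 - p"]) (simp_all add: complex_eq_iff l_scale, simp_all add: algebra_simps)

lemma dir_TR: "has_dir x a b \<Longrightarrow> has_dir (TR x) (r * a - b) (a - r * b)"
  by (erule has_dir_turn[OF _ norms(3), of _ _ _ 1]) (auto simp: complex_eq_iff)

text \<open>The parameter of slope \<open>r\<close>: the chord from there through \<open>R\<close>
  ends at -1, the point with parameter 1/2. The window from 0 to \<open>e\<close> has slopes from 0
  to \<open>r\<close>.\<close>

definition e :: real where "e = arctan r / pi"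

lemma e: "0 < e" "e < 1/2"
  using arctan_ubound[of r] r_pos by (auto simp: e_def field_simps)

lemma has_dir_tan:
  assumes "0 \<le> x" "x < 1/2"
  shows "has_dir x 1 (tan (pi * x))"
proof -
  have "pi * x < pi * (1/2)" using assms(2) by (intro mult_strict_left_mono) auto
  moreover have "0 \<le> pi * x" using assms by simp
  ultimately have "cos (pi * x) > 0" by (intro cos_gt_zero_pi) (use pi_gt_zero in linarith)+
  then show ?thesis unfolding has_dir_def
    by (intro exI[of _ "cos (pi * x)"]) (simp add: complex_eq_iff tan_def)
qed

lemma dir_e: "has_dir e 1 r"
  using has_dir_tan[of e] e by (simp add: e_def tan_arctan)

lemma dir_0: "has_dir 0 1 0" and dir_half: "has_dir (1/2) 0 1" and dir_1: "has_dir 1 (-1) 0"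
  unfolding has_dir_def by (auto intro!: exI[of _ 1] simp: complex_eq_iff)

text \<open>The chord through \<open>P\<close> and \<open>Q\<close> is the real diameter, with ends
  at parameters 0 and 1/2, so both turns exchange these ends.\<close>

lemma TP_0: "TP 0 = 1/2" and TQ_0: "TQ 0 = 1/2"
  using has_dir_eq[OF dir_half dir_TP[OF dir_0]] has_dir_eq[OF dir_half dir_TQ[OF dir_0]]
    turn_bounds[OF norms(1), of 0] turn_bounds[OF norms(2), of 0] by (auto simp: abs_less_iff)

lemma TP_half: "TP (1/2) = 1" and TQ_half: "TQ (1/2) = 1"
  using has_dir_eq[OF dir_1 dir_TP[OF dir_half]] has_dir_eq[OF dir_1 dir_TQ[OF dir_half]]
    turn_bounds[OF norms(1), of "1/2"] turn_bounds[OF norms(2), of "1/2"] by (auto simp: abs_less_iff)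

lemma TR_0: "TR 0 < 1/2"
  using has_dir_less[OF dir_half dir_TR[OF dir_0]] turn_bounds[OF norms(3), of 0] r_pos by auto

lemma TR_e: "TR e = 1/2"
  using has_dir_eq[OF dir_half dir_TR[OF dir_e]] turn_bounds[OF norms(3), of e] e by (auto simp: abs_less_iff)

lemma TR_half: "TR (1/2) = e + 1"
  using has_dir_eq[OF has_dir_add_1[OF dir_e] dir_TR[OF dir_half]] turn_bounds[OF norms(3), of "1/2"] e
  by (auto simp: abs_less_iff)

lemma turn_shifts:
  "TP 1 = 3/2" "TP 2 = 5/2" "TP (5/2) = 3" "TQ (3/2) = 2"
  "TR (3/2) = e + 2" "TR 1 < 3/2"
  using TP_0 TP_half TQ_0 TQ_half TR_0 TR_half
    turn_add_1[of _ 0] turn_add_1[of _ "1/2"] turn_add_1[of _ 1] turn_add_1[of _ "3/2"]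
  by simp_all

lemma tri_le: "F x \<le> TP x" "F x \<le> TQ x" "F x \<le> TR x"
  by (auto simp: tri_def)

text \<open>With \<open>t = tan (pi * x)\<close>, the next two inequalities say that the words \<open>PRPQR\<close> and \<open>PQRQR\<close>
  move \<open>x\<close> to the left of \<open>x + 2\<close>.\<close>

lemma word_PRPQR:
  assumes "0 \<le> t" "t \<le> r / 2"
  shows "(1 - r * t) - r * l\<^sup>2 * (r - t) < t * (l * (l\<^sup>2 * (r - t) - r * (1 - r * t)))"
proof -
  have "t * r * (l\<^sup>2 * (l / 2 - 1) - l) \<ge> 0"
  proof -
    have "l * (l / 2 - 1) \<ge> 1" using mult_mono[of 1 l 1 "l/2 - 1"] l by simp
    then have "l * 1 \<le> l * (l * (l / 2 - 1))" using l by (intro mult_left_mono) auto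
    then show ?thesis using assms r_pos by (auto intro!: mult_nonneg_nonneg simp: power2_eq_square mult.assoc)
  qed
  moreover have "l\<^sup>2 * (t * (l * (r / 2 - t))) \<ge> 0" using assms l by simp
  moreover have "t * l * r * (r * t) \<ge> 0" "r * t \<ge> 0" using assms l r_pos by simp_all
  \<comment> \<open>The difference of the two sides splits into terms that are nonnegative for
    \<open>t \<le> r / 2\<close>, the first being positive by \<open>l2r2\<close>.\<close>
  moreover have "t * (l * (l\<^sup>2 * (r - t) - r * (1 - r * t))) - ((1 - r * t) - r * l\<^sup>2 * (r - t))
     = (l\<^sup>2 * r\<^sup>2 - 1) + t * r * (l\<^sup>2 * (l / 2 - 1) - l) + l\<^sup>2 * (t * (l * (r / 2 - t))) + t * l * r * (r * t) + r * t"
    by (simp add: algebra_simps power2_eq_square)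
  ultimately show ?thesis using l2r2 by linarith
qed

lemma word_PQRQR:
  assumes "r / 2 \<le> t" "t \<le> r"
  shows "(1 - r * t) + r * l * (r - t) < t * (l\<^sup>2 * (r * (1 - r * t) + l * (r - t)))"
proof -
  have rt: "r * t < 1" using mult_strict_mono[of r 1 t 1] assms r r_pos by simp
  have "(1 - r * t) * (l\<^sup>2 * r\<^sup>2 - 1) > 0" using rt l2r2 by simp
  moreover have "(r - t) * (r * l * (l\<^sup>2 / 2 - 1 - l)) \<ge> 0"
  proof -
    have "l * (l / 2 - 1) \<ge> 9 * 1" using l by (intro mult_mono) auto
    then have "l\<^sup>2 / 2 - 1 - l \<ge> 0" by (simp add: power2_eq_square algebra_simps)
    then show ?thesis using assms r_pos l by (intro mult_nonneg_nonneg) auto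
  qed
  moreover have "(r - t) * (l * l\<^sup>2 * (t - r / 2)) \<ge> 0" "(r - t) * (r * t * l\<^sup>2 * r) \<ge> 0"
    using assms l r_pos by (auto intro!: mult_nonneg_nonneg)
  \<comment> \<open>Again a sum of nonnegative terms, now for \<open>r / 2 \<le> t \<le> r\<close>;
    the first is positive because \<open>r * t < 1\<close>.\<close>
  moreover have "t * (l\<^sup>2 * (r * (1 - r * t) + l * (r - t))) - ((1 - r * t) + r * l * (r - t))
     = (1 - r * t) * (l\<^sup>2 * r\<^sup>2 - 1) + (r - t) * (r * l * (l\<^sup>2 / 2 - 1 - l))
      + (r - t) * (l * l\<^sup>2 * (t - r / 2)) + (r - t) * (r * t * l\<^sup>2 * r)"
    by (simp add: algebra_simps power2_eq_square)
  ultimately show ?thesis by linarith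
qed

section \<open>Five iterates on the window\<close>

lemma F_mono: "mono F"
  using tri_strict_mono[OF norms] by (auto intro!: strict_mono_mono strict_monoI)

text \<open>Since \<open>F\<close> is monotone and below each turn, any word of five turns bounds
  the fifth iterate. The word is chosen by the position of the slope relative to
  \<open>r / 2\<close>.\<close>

lemma F5_less_on_window:
  assumes "0 \<le> x" "x \<le> e"
  shows "F (F (F (F (F x)))) < x + 2"
proof -
  define t where "t = tan (pi * x)"
  have dir: "has_dir x 1 t" using assms e has_dir_tan by (simp add: t_def)
  have t: "0 \<le> t" "t \<le> r"
  proof -
    have "pi * x \<le> arctan r" using assms(2) by (simp add: e_def field_simps)
    moreover have "0 \<le> pi * x" using assms by simp
    ultimately have "tan (pi * x) \<le> tan (arctan r)" "tan 0 \<le> tan (pi * x)"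
      using arctan_ubound[of r] pi_gt_zero by (intro tan_mono_le; linarith)+
    then show "0 \<le> t" "t \<le> r" by (simp_all add: t_def tan_arctan)
  qed
  have "has_dir (x + 1 + 1) (- (- 1)) (- (- t))" by (intro has_dir_add_1 dir)
  then have dir2: "has_dir (x + 2) 1 t" by (simp add: add.assoc)
  have le1: "TR x \<le> 1/2" using monoD[OF TR_mono assms(2)] TR_e by simp
  then have le2: "TQ (TR x) \<le> 1" using monoD[OF TQ_mono le1] TQ_half by simp
  have m: "F a \<le> F b" if "a \<le> b" for a b using monoD[OF F_mono that] .
  have mono: "F a \<le> TP b" "F a \<le> TQ b" "F a \<le> TR b" if "a \<le> b" for a b
    using m[OF that] tri_le order_trans by blast+
  show ?thesis
  proof (cases "t \<le> r / 2")
    case True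
    let ?y = "TP (TR (TP (TQ (TR x))))"
    have "TP (TQ (TR x)) \<le> 3/2" using monoD[OF TP_mono le2] turn_shifts by simp
    from monoD[OF TR_mono this] have "TR (TP (TQ (TR x))) < 5/2" using turn_shifts e by simp
    \<comment> \<open>As \<open>x \<ge> 0\<close>, this yields \<open>?y < x + 3\<close>, the a
      priori bound that \<open>has_dir_less\<close> needs for comparing \<open>?y\<close> with
      \<open>x + 2\<close>.\<close>
    then have "?y < 3" using strict(1) turn_shifts by metis
    moreover have "has_dir ?y (- (l * ((- (l * (l * (r * 1 - t)))) - r * (- (1 - r * t)))))
        (r * (- (l * (l * (r * 1 - t)))) - (- (1 - r * t)))"
      by (intro dir_TP dir_TQ dir_TR dir)
    ultimately have "?y < x + 2"
      using word_PRPQR[OF t(1) True] assms(1)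
      by (intro has_dir_less[OF dir2]) (auto simp: algebra_simps power2_eq_square)
    moreover have "F (F (F (F (F x)))) \<le> ?y" by (intro mono order_refl)
    ultimately show ?thesis by simp
  next
    case False
    let ?y = "TP (TQ (TR (TQ (TR x))))"
    have "TR (TQ (TR x)) < 3/2" using monoD[OF TR_mono le2] turn_shifts by simp
    then have "TQ (TR (TQ (TR x))) < 2" using strict(2) turn_shifts by metis
    then have "?y < 5/2" using strict(1) turn_shifts by metis
    moreover have "has_dir ?y (- (l * (l * (r * (- (1 - r * t)) - l * (r * 1 - t)))))
        (- ((- (1 - r * t)) - r * (l * (r * 1 - t))))"
      by (intro dir_TP dir_TQ dir_TR dir)
    ultimately have "?y < x + 2"
      using word_PQRQR[OF _ t(2)] False assms(1)
      by (intro has_dir_less[OF dir2]) (auto simp: algebra_simps power2_eq_square)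
    moreover have "F (F (F (F (F x)))) \<le> ?y" by (intro mono order_refl)
    ultimately show ?thesis by simp
  qed
qed

lemma F_e: "F e = 1/2"
  using TR_e monoD[OF TP_mono, of 0 e] monoD[OF TQ_mono, of 0 e] TP_0 TQ_0 e by (auto simp: tri_def)

lemma F_half: "F (1/2) = 1"
  using TR_half TP_half TQ_half e by (auto simp: tri_def)

text \<open>The word \<open>PQR\<close> takes slope 0 to slope \<open>1 / (l\<^sup>2 * r)\<close>,
  which is below \<open>r\<close> because \<open>l * r > 1\<close>. Hence the third image of the
  window leaves no gap after the window shifted by 1.\<close>

lemma F3_0: "F (F (F 0)) < e + 1"
proof -
  let ?y = "TP (TQ (TR 0))"
  have "TQ (TR 0) \<le> 1" using monoD[OF TQ_mono less_imp_le[OF TR_0]] TQ_half by simp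
  then have "?y \<le> 3/2" using monoD[OF TP_mono] turn_shifts by metis
  moreover have "has_dir ?y (- (l * (l * (r * 1 - 0)))) (- (1 - r * 0))"
    by (intro dir_TP dir_TQ dir_TR dir_0)
  ultimately have "?y < e + 1"
    using l2r2 e by (intro has_dir_less[OF has_dir_add_1[OF dir_e]]) (auto simp: power2_eq_square algebra_simps)
  moreover have "F (F (F 0)) \<le> ?y"
    using monoD[OF F_mono] tri_le by (meson order_trans)
  ultimately show ?thesis by simp
qed

section \<open>Spreading the estimate over the circle\<close>

sublocale circle_map_lift F
  using continuous_on_tri[OF norms] F_mono tri_add_1 by unfold_locales auto

lemma F5_less_shift: "(F ^^ 5) (x + of_int k) < (x + of_int k) + 2 \<longleftrightarrow> (F ^^ 5) x < x + 2"
  by (simp add: funpow_add_of_int)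

text \<open>The inequality travels along orbits, as \<open>F ^^ n\<close> is strictly increasing and
  commutes with \<open>F ^^ 5\<close> and with the shift by 2.\<close>

lemma F5_less_funpow:
  assumes "(F ^^ 5) x < x + 2"
  shows "(F ^^ 5) ((F ^^ n) x) < (F ^^ n) x + 2"
proof -
  have "(F ^^ n) a < (F ^^ n) b" if "a < b" for a b
    using that tri_strict_mono[OF norms] by (induction n) auto
  from this[OF assms] have "(F ^^ n) ((F ^^ 5) x) < (F ^^ n) x + 2"
    using funpow_add_of_nat[of n x 2] by simp
  moreover have "(F ^^ n) ((F ^^ 5) x) = (F ^^ 5) ((F ^^ n) x)"
    by (simp only: funpow_add[symmetric, THEN fun_cong, unfolded comp_def] add.commute)
  ultimately show ?thesis by simp
qed

lemma F5_less_between: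
  assumes "(F ^^ n) 0 \<le> y" "y \<le> (F ^^ n) e"
  shows "(F ^^ 5) y < y + 2"
proof -
  obtain z where z: "0 \<le> z" "z \<le> e" "(F ^^ n) z = y"
    using IVT'[of "F ^^ n" 0 y e] assms e continuous_on_funpow by auto
  have "(F ^^ 5) z < z + 2" using F5_less_on_window[OF z(1,2)] by (simp add: eval_nat_numeral)
  from F5_less_funpow[OF this, of n] show ?thesis by (simp add: z(3))
qed

text \<open>The intervals from \<open>F\<^sup>n 0\<close> to \<open>F\<^sup>n e\<close> for \<open>n = 0, 3, 1, 4, 2\<close>, in this order, cover the unit
  interval modulo integers, because \<open>F e = 1/2\<close>, \<open>F (1/2) = 1\<close> and \<open>F\<^sup>3 0 < e + 1\<close>.\<close>

lemma F5_less: "(F ^^ 5) x < x + 2"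
proof -
  have F1: "F 1 = F 0 + 1" using add_1[of 0] by simp
  have F3e: "(F ^^ 3) e = F 0 + 1" "(F ^^ 4) e = F (F 0) + 1" "(F ^^ 2) e = 1" "(F ^^ 1) e = 1/2"
    by (simp_all add: eval_nat_numeral F_e F_half F1 add_1)
  have F40: "(F ^^ 4) 0 \<le> 3/2"
    using monoD[OF F_mono less_imp_le[OF F3_0]] add_1[of e] F_e by (simp add: eval_nat_numeral)
  \<comment> \<open>The images of the window for \<open>n = 3\<close> and \<open>n = 4\<close> lie
    one full turn further on, so cases 2 and 4 treat \<open>y + 1\<close>.\<close>
  have shift: "(F ^^ 5) y < y + 2" if "(F ^^ 5) (y + 1) < (y + 1) + 2" for y
    using that F5_less_shift[of y 1] by simp
  have unit: "(F ^^ 5) y < y + 2" if "0 \<le> y" "y \<le> 1" for y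
  proof -
    consider "y \<le> e" | "e \<le> y" "y \<le> F 0" | "F 0 \<le> y" "y \<le> 1/2" | "1/2 \<le> y" "y \<le> F (F 0)" | "F (F 0) \<le> y"
      by linarith
    then show ?thesis
    proof cases
      case 1 then show ?thesis using F5_less_between[of 0 y] that by simp
    next
      case 2
      then show ?thesis using F3_0 F3e by (intro shift[OF F5_less_between[of 3]]) (auto simp: eval_nat_numeral)
    next
      case 3 then show ?thesis using F5_less_between[of 1 y] F3e by simp
    next
      case 4
      then show ?thesis using F40 F3e by (intro shift[OF F5_less_between[of 4]]) auto
    next
      case 5
      then show ?thesis using F5_less_between[of 2 y] F3e that by (simp add: eval_nat_numeral)
    qed
  qed
  have "0 \<le> frac x" "frac x \<le> 1" using frac_lt_1[of x] by auto
  from unit[OF this] show ?thesis using F5_less_shift[of "frac x" "\<lfloor>x\<rfloor>"] by (simp add: frac_def)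
qed

end

subsection \<open>Reduction to the normalised triangle\<close>

lemma tri_swap: "tri P Q R = tri Q P R"
  by (auto simp: tri_def fun_eq_iff min.left_commute)

lemma tri_funpow_less_standard:
  assumes "admissible l (of_real p) (- of_real p) R" "p > 0" "Im R \<ge> 0"
  shows "(tri (of_real p) (- of_real p) R ^^ 5) x < x + 2"
proof -
  obtain r where std: "R = \<i> * of_real r" "p < 1" "l = (1 + p) / (1 - p)" "1 / l < r" "r < 1"
    using admissible_standard[OF assms] by blast
  interpret standard_triangle p l r
    using std assms by unfold_locales (auto simp: admissible_def)
  show ?thesis unfolding std(1) by (rule F5_less)
qed

lemma tri_funpow_less_antipodal:
  assumes "admissible l P (- P) R"
  shows "(tri P (- P) R ^^ 5) x < x + 2"
proof -
  define p where "p = norm P"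
  have p: "p > 0" using assms by (auto simp: admissible_def p_def)
  define \<theta> where "\<theta> = - Arg P / (2 * pi)"
  have \<theta>: "2 * pi * \<theta> = - Arg P" by (simp add: \<theta>_def)
  have "P = of_real p * cis (Arg P)" using rcis_cmod_Arg[of P] by (simp add: p_def rcis_def)
  then have P: "P * cis (2 * pi * \<theta>) = of_real p"
    unfolding \<theta> by (metis add.right_inverse cis_mult cis_zero mult.assoc mult.right_neutral)
  define R' where "R' = R * cis (2 * pi * \<theta>)"
  have adm: "admissible l (of_real p) (- of_real p) R'"
    using admissible_rotate[OF assms, of "2 * pi * \<theta>"] by (simp add: P R'_def)
  have "(tri (of_real p) (- of_real p) R' ^^ 5) y < y + 2" for y
  proof (cases "Im R' \<ge> 0")
    case True
    then show ?thesis using tri_funpow_less_standard[OF adm p] by simp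
  next
    case False
    \<comment> \<open>Rotation by \<open>pi\<close> moves \<open>R'\<close> to the upper half-plane
      and exchanges \<open>p\<close> with \<open>-p\<close>; swapping the first two vertices
      restores their order.\<close>
    have "admissible l (of_real p) (- of_real p) (- R')"
      using admissible_swap[OF admissible_rotate[OF adm, of pi]] by simp
    then have "(tri (of_real p) (- of_real p) (- R') ^^ 5) z < z + 2" for z
      using tri_funpow_less_standard p False by simp
    then show ?thesis
      using tri_funpow_rotate[where \<theta> = "1/2" and P = "of_real p" and Q = "- of_real p" and R = R']
      by (simp add: tri_swap[of "- of_real p"])
  qed
  then show ?thesis
    using tri_funpow_rotate[where \<theta> = \<theta> and P = P and Q = "- P" and R = R] by (simp add: P R'_def)
qed

text \<open>An isometry moving the midpoint of \<open>P\<close> and \<open>Q\<close> to 0 makes them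
  antipodal: their images are distinct, have equal norm, and 0 lies on their line.\<close>

lemma tri_funpow_less:
  assumes "admissible l P Q R"
  shows "(tri P Q R ^^ 5) x < x + 2"
proof -
  have n: "norm P < 1" "norm Q < 1" "norm R < 1" using assms by (auto simp: admissible_def)
  obtain S where S: "norm S < 1" "on_line P Q S" "cosh_sq P S = cosh_sq Q S"
    using hyperbolic_midpoint n by blast
  obtain A where A: "norm A < 1" "half_turn A S = 0" using half_turn_to_0[OF S(1)] by blast
  define P' Q' where PQ': "P' = half_turn A P" "Q' = half_turn A Q"
  have adm: "admissible l P' Q' (half_turn A R)"
    unfolding PQ' by (rule admissible_half_turn[OF assms A(1)])
  have n': "P' \<bullet> P' < 1" "Q' \<bullet> Q' < 1" "P' \<noteq> Q'" using adm by (auto simp: admissible_def norm_less_1_iff)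
  have "cosh_sq P' 0 = cosh_sq Q' 0"
    using cosh_sq_half_turn[OF A(1) n(1) S(1)] cosh_sq_half_turn[OF A(1) n(2) S(1)] S(3) A(2) PQ' by simp
  then have "P' \<bullet> P' = Q' \<bullet> Q'" using n' by (simp add: cosh_sq_def)
  then have eq: "norm P' = norm Q'" by (simp add: norm_eq_sqrt_inner)
  have "on_line P' Q' 0" using on_line_half_turn[OF A(1) n(1,2) S(1,2)] by (simp add: A(2) PQ')
  then obtain t where "0 = P' + of_real t * (Q' - P')" by (auto simp: on_line_def)
  then have t: "of_real (1 - t) * P' = - (of_real t * Q')" by (simp add: algebra_simps add_eq_0_iff)
  then have "norm (of_real (1 - t) * P') = norm (of_real t * Q')" by simp
  then have "\<bar>1 - t\<bar> * norm P' = \<bar>t\<bar> * norm P'" by (simp only: norm_mult norm_of_real eq)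
  moreover have "norm P' \<noteq> 0" using n'(3) eq by auto
  ultimately have half: "t = 1/2" by (auto simp: abs_if split: if_splits)
  have "of_real (1/2) * P' = of_real (1/2) * (- Q')" using t unfolding half by simp
  then have "Q' = - P'" by simp
  then have "(tri P' Q' (half_turn A R) ^^ 5) y < y + 2" for y
    using tri_funpow_less_antipodal adm by simp
  then show ?thesis using tri_funpow_half_turn[OF A(1) n] PQ' by simp
qed

theorem theorem6p17:
  fixes P Q R :: complex
  assumes "P \<in> ball 0 1" "Q \<in> ball 0 1" "R \<in> ball 0 1"
    and "\<not> collinear {P, Q, R}"
    and "dK P R = dK Q R"
    and "dK P Q > ln 9"
    and "deltaK P Q R > DeltaK 1 P Q / 2"
  shows "rot_num (psi (convex hull {P, Q, R})) < 2 / 5"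
proof -
  have n: "norm P < 1" "norm Q < 1" "norm R < 1" using assms(1-3) by auto
  show ?thesis
    using rot_num_triangle_less[OF n tri_funpow_less[OF admissible_if_dK[OF n assms(5-7)]]] .
qed

end
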